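(* Let $\Omega$ be a compact Hausdorff space and let $H$ be a complex Hilbert space. Then every weak-2-local derivation $\Delta: C(\Omega,B(H))\to C(\Omega,B(H))$ is a (linear) derivation. Furthermore, for every atomic von Neumann algebra $A$, every weak-2-local derivation $\Delta: C(\Omega,A)\to C(\Omega,A)$ is a (linear) derivation.
   Context: $B(H)$ is the C$^*$-algebra of all bounded linear operators on $H$. For a C$^*$-algebra $A$, $C(\Omega,A)$ denotes the C$^*$-algebra of all (norm-)continuous functions $\Omega\to A$ with pointwise operations and the sup norm. An atomic von Neumann algebra is one that is isomorphic to an $\ell_\infty$-sum $\bigoplus_{i}^{\ell_\infty} B(H_i)$ for some family of complex Hilbert spaces $H_i$. A derivation on a C$^*$-algebra $B$ is a linear map $D:B\to B$ with $D(ab)=D(a)b+aD(b)$ for all $a,b\in B$. A weak-2-local derivation on $B$ is a mapping $\Delta:B\to B$ (not assumed linear or continuous) such that for all $a,b\in B$ and every $\phi\in B^*$ there exists a derivation $D_{a,b,\phi}:B\to B$, depending on $a$, $b$ and $\phi$, with $\phi(\Delta(a))=\phi(D_{a,b,\phi}(a))$ and $\phi(\Delta(b))=\phi(D_{a,b,\phi}(b))$. *)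

theory Defs
  imports "HOL-Analysis.Analysis" "HOL-Algebra.Module"
begin

text \<open>
  Hilbert spaces and C*-algebras are represented by records with an explicit carrier set, in the
  style of HOL-Algebra, because the atomic von Neumann algebras involve arbitrary families
  of Hilbert spaces.
  A complex vector space is a \<^locale>\<open>module\<close> over the field of complex numbers.
  The fields \<^const>\<open>mult\<close> and \<^const>\<open>one\<close> inherited from \<^typ>\<open>('r, 'a) module\<close> carry no
  meaning for Hilbert spaces, and \<^const>\<open>one\<close> carries none for C*-algebras
  (which need not be unital).
\<close>

definition complex_field :: "(complex, complex) module" where
  "complex_field = \<lparr>carrier = UNIV, mult = (*), one = 1, zero = 0, add = (+), smult = (*)\<rparr>"

definition linear_maps ::
    "(complex, 'a, 'm) module_scheme \<Rightarrow> (complex, 'b, 'n) module_scheme \<Rightarrow> ('a \<Rightarrow> 'b) set" where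
  "linear_maps V W =
    {T \<in> carrier V \<rightarrow> carrier W.
      (\<forall>x\<in>carrier V. \<forall>y\<in>carrier V. T (x \<oplus>\<^bsub>V\<^esub> y) = T x \<oplus>\<^bsub>W\<^esub> T y) \<and>
      (\<forall>c. \<forall>x\<in>carrier V. T (c \<odot>\<^bsub>V\<^esub> x) = c \<odot>\<^bsub>W\<^esub> T x)}"

text \<open>
  The library's \<^locale>\<open>Metric_space\<close> requires nonnegativity and symmetry of the distance function
  on the whole type, hence the case distinction.
\<close>

definition norm_dist :: "('r, 'a, 'm) module_scheme \<Rightarrow> ('a \<Rightarrow> real) \<Rightarrow> 'a \<Rightarrow> 'a \<Rightarrow> real" where
  "norm_dist V N x y = (if x \<in> carrier V \<and> y \<in> carrier V then N (x \<ominus>\<^bsub>V\<^esub> y) else 0)"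

locale complex_normed_space = module complex_field V
  for V :: "(complex, 'a, 'm) module_scheme" (structure) and N :: "'a \<Rightarrow> real" +
  assumes norm_nonneg: "x \<in> carrier V \<Longrightarrow> 0 \<le> N x"
    and norm_eq_zero: "x \<in> carrier V \<Longrightarrow> N x = 0 \<longleftrightarrow> x = \<zero>"
    and norm_smult: "x \<in> carrier V \<Longrightarrow> N (c \<odot> x) = cmod c * N x"
    and norm_triangle: "\<lbrakk>x \<in> carrier V; y \<in> carrier V\<rbrakk> \<Longrightarrow> N (x \<oplus> y) \<le> N x + N y"
begin

lemma norm_uminus:
  assumes "x \<in> carrier V" shows "N (\<ominus> x) = N x"
proof -
  have zero: "(0::complex) \<odot> x = \<zero>"
    using smult_l_null[OF assms] by (simp add: complex_field_def)
  have "(-1::complex) \<odot> x \<oplus> x = (-1::complex) \<odot> x \<oplus> (1::complex) \<odot> x"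
    using smult_one[OF assms] by (simp add: complex_field_def)
  also have "\<dots> = (0::complex) \<odot> x"
    using smult_l_distr[of "-1" 1 x] assms by (simp add: complex_field_def)
  finally have "(-1::complex) \<odot> x \<oplus> x = \<zero>" by (simp add: zero)
  moreover have "(-1::complex) \<odot> x \<in> carrier V"
    using smult_closed[of "-1" x] assms by (simp add: complex_field_def)
  ultimately have "\<ominus> x = (-1::complex) \<odot> x"
    using M.minus_equality assms by blast
  then show ?thesis by (simp add: norm_smult assms)
qed

lemma Metric_space_norm_dist: "Metric_space (carrier V) (norm_dist V N)"
proof
  fix x y z
  show "0 \<le> norm_dist V N x y"
    by (simp add: norm_dist_def norm_nonneg)
  have "N (x \<ominus> y) = N (y \<ominus> x)" if "x \<in> carrier V" "y \<in> carrier V"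
    using norm_uminus[of "x \<ominus> y"] that
    by (simp add: a_minus_def M.minus_add M.a_comm)
  then show "norm_dist V N x y = norm_dist V N y x"
    by (simp add: norm_dist_def)
  show "norm_dist V N x y = 0 \<longleftrightarrow> x = y" if "x \<in> carrier V" "y \<in> carrier V"
    using that M.minus_equality[of x "\<ominus> y"]
    by (auto simp: norm_dist_def norm_eq_zero a_minus_def M.r_neg)
  show "norm_dist V N x z \<le> norm_dist V N x y + norm_dist V N y z"
    if "x \<in> carrier V" "y \<in> carrier V" "z \<in> carrier V"
  proof -
    have "(x \<ominus> y) \<oplus> (y \<ominus> z) = x \<ominus> z"
      using that by (simp add: a_minus_def M.a_assoc M.r_neg1)
    then show ?thesis
      using norm_triangle[of "x \<ominus> y" "y \<ominus> z"] that by (simp add: norm_dist_def)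
  qed
qed

end


section \<open>Hilbert spaces\<close>

record 'a inner_space = "(complex, 'a) module" +
  cinner :: "'a \<Rightarrow> 'a \<Rightarrow> complex"

definition hnorm :: "'a inner_space \<Rightarrow> 'a \<Rightarrow> real" where
  "hnorm H x = sqrt (Re (cinner H x x))"

locale complex_inner_product_space = module complex_field H
  for H :: "'a inner_space" (structure) +
  assumes cinner_add_left:
      "\<lbrakk>x \<in> carrier H; y \<in> carrier H; z \<in> carrier H\<rbrakk>
        \<Longrightarrow> cinner H (x \<oplus> y) z = cinner H x z + cinner H y z"
    and cinner_smult_left:
      "\<lbrakk>x \<in> carrier H; y \<in> carrier H\<rbrakk> \<Longrightarrow> cinner H (c \<odot> x) y = c * cinner H x y"
    and cinner_commute:
      "\<lbrakk>x \<in> carrier H; y \<in> carrier H\<rbrakk> \<Longrightarrow> cinner H x y = cnj (cinner H y x)"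
    and cinner_nonneg: "x \<in> carrier H \<Longrightarrow> 0 \<le> Re (cinner H x x)"
    and cinner_eq_zero: "\<lbrakk>x \<in> carrier H; cinner H x x = 0\<rbrakk> \<Longrightarrow> x = \<zero>"
begin

lemma cinner_add_right:
  "\<lbrakk>x \<in> carrier H; y \<in> carrier H; z \<in> carrier H\<rbrakk>
    \<Longrightarrow> cinner H x (y \<oplus> z) = cinner H x y + cinner H x z"
  by (subst (1 2 3) cinner_commute) (auto simp: cinner_add_left)

lemma smult_carrier: "x \<in> carrier H \<Longrightarrow> c \<odot> x \<in> carrier H"
  using smult_closed[of c x] by (simp add: complex_field_def)

lemma cinner_smult_right:
  "\<lbrakk>x \<in> carrier H; y \<in> carrier H\<rbrakk> \<Longrightarrow> cinner H x (c \<odot> y) = cnj c * cinner H x y"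
  by (subst (1 2) cinner_commute) (auto simp: cinner_smult_left smult_carrier)

lemma cinner_self_real:
  assumes "x \<in> carrier H" shows "cinner H x x = of_real (Re (cinner H x x))"
  using cinner_commute[OF assms assms] by (simp add: complex_eq_iff)

lemma hnorm_power2: "x \<in> carrier H \<Longrightarrow> (hnorm H x)\<^sup>2 = Re (cinner H x x)"
  by (simp add: hnorm_def cinner_nonneg)

lemma cinner_zero_left: "x \<in> carrier H \<Longrightarrow> cinner H \<zero> x = 0"
  using cinner_add_left[of \<zero> \<zero> x] by simp

lemma Cauchy_Schwarz:
  assumes x: "x \<in> carrier H" and y: "y \<in> carrier H"
  shows "cmod (cinner H x y) \<le> hnorm H x * hnorm H y"
proof -
  define p q w where "p = Re (cinner H x x)" and "q = Re (cinner H y y)" and "w = cinner H x y"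
  have expand: "0 \<le> s\<^sup>2 * p - 2 * s * r * (cmod w)\<^sup>2 + r\<^sup>2 * (cmod w)\<^sup>2 * q" for s r :: real
  proof -
    define v where "v = of_real s \<odot> x \<oplus> (- (of_real r * w)) \<odot> y"
    have yx: "cinner H y x = cnj w"
      using cinner_commute[OF y x] by (simp add: w_def)
    have "cinner H v v = of_real s * of_real s * cinner H x x
        - 2 * of_real s * of_real r * (w * cnj w) + of_real r * of_real r * (w * cnj w) * cinner H y y"
      unfolding v_def using x y
      by (simp add: cinner_add_left cinner_add_right cinner_smult_left cinner_smult_right
          smult_carrier yx flip: w_def) (simp add: algebra_simps)
    also have "\<dots> = of_real (s\<^sup>2 * p - 2 * s * r * (cmod w)\<^sup>2 + r\<^sup>2 * (cmod w)\<^sup>2 * q)"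
      using cinner_self_real[OF x] cinner_self_real[OF y]
      by (simp add: p_def q_def power2_eq_square flip: complex_norm_square)
    finally show ?thesis
      using cinner_nonneg[of v] x y by (simp add: v_def smult_carrier)
  qed
  have "(cmod w)\<^sup>2 \<le> p * q"
  proof (cases "q = 0")
    case True
    then have "y = \<zero>"
      using cinner_eq_zero[OF y] cinner_self_real[OF y] by (simp add: q_def)
    then have "cinner H y x = 0"
      using cinner_zero_left x by simp
    then show ?thesis
      using cinner_commute[OF x y] True by (simp add: w_def)
  next
    case False
    then have "q > 0" using cinner_nonneg[OF y] by (simp add: q_def)
    have "0 \<le> q\<^sup>2 * p - q * (cmod w)\<^sup>2"
      using expand[of q 1] by (simp add: power2_eq_square algebra_simps)
    then have "0 \<le> q * (p * q - (cmod w)\<^sup>2)"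
      by (simp add: power2_eq_square algebra_simps)
    then show ?thesis using \<open>q > 0\<close> by (simp add: zero_le_mult_iff)
  qed
  then have "cmod w \<le> sqrt (p * q)" by (rule real_le_rsqrt)
  then show ?thesis by (simp add: hnorm_def p_def q_def w_def real_sqrt_mult)
qed

sublocale complex_normed_space H "hnorm H"
proof
  fix x y c
  assume x: "x \<in> carrier H"
  show "0 \<le> hnorm H x" by (simp add: hnorm_def cinner_nonneg x)
  show "hnorm H x = 0 \<longleftrightarrow> x = \<zero>"
    using cinner_self_real[OF x] cinner_eq_zero[OF x] cinner_zero_left[of \<zero>]
    by (auto simp: hnorm_def)
  have "cinner H (c \<odot> x) (c \<odot> x) = of_real ((cmod c)\<^sup>2 * Re (cinner H x x))"
    using cinner_self_real[OF x] x
    by (simp add: cinner_smult_left cinner_smult_right smult_carrier complex_norm_square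
        mult.assoc del: of_real_power)
  then show "hnorm H (c \<odot> x) = cmod c * hnorm H x"
    by (simp add: hnorm_def real_sqrt_mult)
  assume y: "y \<in> carrier H"
  have "(hnorm H (x \<oplus> y))\<^sup>2 = (hnorm H x)\<^sup>2 + (hnorm H y)\<^sup>2 + 2 * Re (cinner H x y)"
    using cinner_commute[OF y x] x y
    by (simp add: hnorm_power2 cinner_add_left cinner_add_right)
  also have "\<dots> \<le> (hnorm H x + hnorm H y)\<^sup>2"
    using Cauchy_Schwarz[OF x y] complex_Re_le_cmod[of "cinner H x y"]
    by (simp add: power2_sum)
  finally show "hnorm H (x \<oplus> y) \<le> hnorm H x + hnorm H y"
    by (rule power2_le_imp_le) (simp add: hnorm_def cinner_nonneg x y)
qed

end

locale hilbert_space = complex_inner_product_space +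
  assumes complete: "Metric_space.mcomplete (carrier H) (norm_dist H (hnorm H))"


section \<open>C*-algebras\<close>

record 'a star_algebra = "(complex, 'a) module" +
  star :: "'a \<Rightarrow> 'a"
  anorm :: "'a \<Rightarrow> real"

locale cstar_algebra = complex_normed_space A "anorm A"
  for A :: "'a star_algebra" (structure) +
  assumes mult_closed: "\<lbrakk>x \<in> carrier A; y \<in> carrier A\<rbrakk> \<Longrightarrow> x \<otimes> y \<in> carrier A"
    and mult_assoc:
      "\<lbrakk>x \<in> carrier A; y \<in> carrier A; z \<in> carrier A\<rbrakk> \<Longrightarrow> (x \<otimes> y) \<otimes> z = x \<otimes> (y \<otimes> z)"
    and distrib_right:
      "\<lbrakk>x \<in> carrier A; y \<in> carrier A; z \<in> carrier A\<rbrakk> \<Longrightarrow> (x \<oplus> y) \<otimes> z = x \<otimes> z \<oplus> y \<otimes> z"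
    and distrib_left:
      "\<lbrakk>x \<in> carrier A; y \<in> carrier A; z \<in> carrier A\<rbrakk> \<Longrightarrow> x \<otimes> (y \<oplus> z) = x \<otimes> y \<oplus> x \<otimes> z"
    and smult_mult_left:
      "\<lbrakk>x \<in> carrier A; y \<in> carrier A\<rbrakk> \<Longrightarrow> (c \<odot> x) \<otimes> y = c \<odot> (x \<otimes> y)"
    and smult_mult_right:
      "\<lbrakk>x \<in> carrier A; y \<in> carrier A\<rbrakk> \<Longrightarrow> x \<otimes> (c \<odot> y) = c \<odot> (x \<otimes> y)"
    and anorm_mult:
      "\<lbrakk>x \<in> carrier A; y \<in> carrier A\<rbrakk> \<Longrightarrow> anorm A (x \<otimes> y) \<le> anorm A x * anorm A y"
    and star_closed: "x \<in> carrier A \<Longrightarrow> star A x \<in> carrier A"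
    and star_star: "x \<in> carrier A \<Longrightarrow> star A (star A x) = x"
    and star_add:
      "\<lbrakk>x \<in> carrier A; y \<in> carrier A\<rbrakk> \<Longrightarrow> star A (x \<oplus> y) = star A x \<oplus> star A y"
    and star_smult: "x \<in> carrier A \<Longrightarrow> star A (c \<odot> x) = cnj c \<odot> star A x"
    and star_mult:
      "\<lbrakk>x \<in> carrier A; y \<in> carrier A\<rbrakk> \<Longrightarrow> star A (x \<otimes> y) = star A y \<otimes> star A x"
    and cstar_identity: "x \<in> carrier A \<Longrightarrow> anorm A (star A x \<otimes> x) = (anorm A x)\<^sup>2"
    and complete: "Metric_space.mcomplete (carrier A) (norm_dist A (anorm A))"

definition star_isomorphisms :: "'a star_algebra \<Rightarrow> 'b star_algebra \<Rightarrow> ('a \<Rightarrow> 'b) set" where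
  "star_isomorphisms A B =
    {\<pi> \<in> linear_maps A B. bij_betw \<pi> (carrier A) (carrier B) \<and>
      (\<forall>x\<in>carrier A. \<forall>y\<in>carrier A. \<pi> (x \<otimes>\<^bsub>A\<^esub> y) = \<pi> x \<otimes>\<^bsub>B\<^esub> \<pi> y) \<and>
      (\<forall>x\<in>carrier A. \<pi> (star A x) = star B (\<pi> x))}"

definition dual_space :: "'a star_algebra \<Rightarrow> ('a \<Rightarrow> complex) set" where
  "dual_space A =
    {\<phi> \<in> linear_maps A complex_field. \<exists>K. \<forall>x\<in>carrier A. cmod (\<phi> x) \<le> K * anorm A x}"


section \<open>The algebras $B(H)$, $\ell_\infty$-sums, and $C(\Omega, A)$\<close>

text \<open>
  Elements of these algebras are functions with a prescribed domain, represented as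
  \<^const>\<open>extensional\<close> functions on that domain.
\<close>

definition bounded_operators :: "'a inner_space \<Rightarrow> ('a \<Rightarrow> 'a) set" where
  "bounded_operators H =
    {T \<in> linear_maps H H \<inter> extensional (carrier H).
      \<exists>K. \<forall>x\<in>carrier H. hnorm H (T x) \<le> K * hnorm H x}"

definition adjoint_operator :: "'a inner_space \<Rightarrow> ('a \<Rightarrow> 'a) \<Rightarrow> ('a \<Rightarrow> 'a)" where
  "adjoint_operator H T =
    (THE S. S \<in> bounded_operators H \<and>
      (\<forall>x\<in>carrier H. \<forall>y\<in>carrier H. cinner H (T x) y = cinner H x (S y)))"

definition operator_algebra :: "'a inner_space \<Rightarrow> ('a \<Rightarrow> 'a) star_algebra" where
  "operator_algebra H =
    \<lparr>carrier = bounded_operators H,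
     mult = (\<lambda>S T. \<lambda>x\<in>carrier H. S (T x)),
     one = (\<lambda>x\<in>carrier H. x),
     zero = (\<lambda>x\<in>carrier H. \<zero>\<^bsub>H\<^esub>),
     add = (\<lambda>S T. \<lambda>x\<in>carrier H. S x \<oplus>\<^bsub>H\<^esub> T x),
     smult = (\<lambda>c T. \<lambda>x\<in>carrier H. c \<odot>\<^bsub>H\<^esub> T x),
     star = adjoint_operator H,
     anorm = (\<lambda>T. SUP x\<in>{x \<in> carrier H. hnorm H x \<le> 1}. hnorm H (T x))\<rparr>"

text \<open>
  In the two sup norms below, the value 0 is inserted for the degenerate case of an empty index
  set (or empty space), since the supremum of the empty set of reals is unspecified.
\<close>

definition linf_sum :: "'i set \<Rightarrow> ('i \<Rightarrow> 'a star_algebra) \<Rightarrow> ('i \<Rightarrow> 'a) star_algebra" where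
  "linf_sum I A =
    \<lparr>carrier = {a \<in> \<Pi>\<^sub>E i\<in>I. carrier (A i). bdd_above ((\<lambda>i. anorm (A i) (a i)) ` I)},
     mult = (\<lambda>a b. \<lambda>i\<in>I. a i \<otimes>\<^bsub>A i\<^esub> b i),
     one = (\<lambda>i\<in>I. \<one>\<^bsub>A i\<^esub>),
     zero = (\<lambda>i\<in>I. \<zero>\<^bsub>A i\<^esub>),
     add = (\<lambda>a b. \<lambda>i\<in>I. a i \<oplus>\<^bsub>A i\<^esub> b i),
     smult = (\<lambda>c a. \<lambda>i\<in>I. c \<odot>\<^bsub>A i\<^esub> a i),
     star = (\<lambda>a. \<lambda>i\<in>I. star (A i) (a i)),
     anorm = (\<lambda>a. Sup (insert 0 ((\<lambda>i. anorm (A i) (a i)) ` I)))\<rparr>"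

definition norm_topology :: "'a star_algebra \<Rightarrow> 'a topology" where
  "norm_topology A = Metric_space.mtopology (carrier A) (norm_dist A (anorm A))"

definition continuous_functions :: "'w topology \<Rightarrow> 'a star_algebra \<Rightarrow> ('w \<Rightarrow> 'a) star_algebra" where
  "continuous_functions \<Omega> A =
    \<lparr>carrier = {f \<in> extensional (topspace \<Omega>). continuous_map \<Omega> (norm_topology A) f},
     mult = (\<lambda>f g. \<lambda>t\<in>topspace \<Omega>. f t \<otimes>\<^bsub>A\<^esub> g t),
     one = (\<lambda>t\<in>topspace \<Omega>. \<one>\<^bsub>A\<^esub>),
     zero = (\<lambda>t\<in>topspace \<Omega>. \<zero>\<^bsub>A\<^esub>),
     add = (\<lambda>f g. \<lambda>t\<in>topspace \<Omega>. f t \<oplus>\<^bsub>A\<^esub> g t),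
     smult = (\<lambda>c f. \<lambda>t\<in>topspace \<Omega>. c \<odot>\<^bsub>A\<^esub> f t),
     star = (\<lambda>f. \<lambda>t\<in>topspace \<Omega>. star A (f t)),
     anorm = (\<lambda>f. Sup (insert 0 ((\<lambda>t. anorm A (f t)) ` topspace \<Omega>)))\<rparr>"

text \<open>
  The types of indices and of vectors cannot be quantified existentially inside a formula, so
  they are explicit parameters; a theorem about all atomic von Neumann algebras is polymorphic in
  \<open>'i\<close> and \<open>'h\<close>. Letting all \<open>H i\<close> have carriers in one type is no restriction, since any
  family of Hilbert spaces can be placed in a disjoint union.
\<close>

definition atomic_von_neumann_algebra ::
    "'i itself \<Rightarrow> 'h itself \<Rightarrow> 'a star_algebra \<Rightarrow> bool" where
  "atomic_von_neumann_algebra _ _ A \<longleftrightarrow>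
    cstar_algebra A \<and>
    (\<exists>(I :: 'i set) (H :: 'i \<Rightarrow> 'h inner_space).
      (\<forall>i\<in>I. hilbert_space (H i)) \<and>
      star_isomorphisms A (linf_sum I (\<lambda>i. operator_algebra (H i))) \<noteq> {})"


section \<open>Derivations and weak-2-local derivations\<close>

definition derivation :: "'a star_algebra \<Rightarrow> ('a \<Rightarrow> 'a) \<Rightarrow> bool" where
  "derivation B D \<longleftrightarrow>
    D \<in> linear_maps B B \<and>
    (\<forall>a\<in>carrier B. \<forall>b\<in>carrier B. D (a \<otimes>\<^bsub>B\<^esub> b) = (D a \<otimes>\<^bsub>B\<^esub> b) \<oplus>\<^bsub>B\<^esub> (a \<otimes>\<^bsub>B\<^esub> D b))"

definition weak_2_local_derivation :: "'a star_algebra \<Rightarrow> ('a \<Rightarrow> 'a) \<Rightarrow> bool" where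
  "weak_2_local_derivation B \<Delta> \<longleftrightarrow>
    \<Delta> \<in> carrier B \<rightarrow> carrier B \<and>
    (\<forall>a\<in>carrier B. \<forall>b\<in>carrier B. \<forall>\<phi>\<in>dual_space B.
      \<exists>D. derivation B D \<and> \<phi> (\<Delta> a) = \<phi> (D a) \<and> \<phi> (\<Delta> b) = \<phi> (D b))"

end

theory Submission
  imports Defs
begin

text \<open>
  For a minimal idempotent \<open>p\<close> write \<open>pxp = \<tau>(x) p\<close>. A derivation \<open>D\<close> satisfies
  \<open>\<tau>(D x) = - \<tau>(D(p) x) - \<tau>(x D(p))\<close>. The off-diagonal element \<open>b = pa + ap - 2 \<tau>(a) p\<close> has
  \<open>\<tau>(D b) = \<tau>(D a)\<close>, and \<open>\<phi>(x) = \<tau>(xb) + \<tau>(bx)\<close> satisfies \<open>\<phi>(D b) = 0\<close> because \<open>b\<^sup>2\<close> is diagonal;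
  comparing \<open>\<tau>\<close>, \<open>\<phi>\<close> and \<open>\<phi> + \<tau>\<close> on \<open>a\<close>, \<open>b\<close>, \<open>b + p\<close> and \<open>p\<close>, two at a time, transfers the formula to a
  weak-2-local derivation \<open>\<Delta>\<close>. Hence \<open>\<Delta>\<close> is linear as soon as the functionals \<open>\<tau>\<close> separate points.

  The implication from \<open>xa = 0 = ay\<close> to \<open>x \<Delta>(a) y = 0\<close> also transfers. For linear \<open>\<Delta>\<close> it gives
  \<open>\<Delta>(vxw) + v \<Delta>(x) w = \<Delta>(vx) w + v \<Delta>(xw)\<close> for idempotents \<open>v\<close>, \<open>w\<close>, then for \<open>v = pa\<close> and \<open>w = bp\<close>,
  which are combinations of two idempotents; four instances combine to the Leibniz rule compressed by \<open>p\<close>.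

  On \<open>C(\<Omega>, A)\<close> the value \<open>D(a)(t)\<close> of a derivation depends on \<open>a(t)\<close> only, so \<open>\<Delta>\<close> acts on the fibre at
  \<open>t\<close> as a weak-2-local derivation of \<open>A\<close>.
\<close>

section \<open>Algebras separated by minimal idempotents\<close>

locale unital_normed_algebra = complex_normed_space A "anorm A" + ring A
  for A :: "'a star_algebra" (structure) +
  assumes smult_mult_left: "\<lbrakk>x \<in> carrier A; y \<in> carrier A\<rbrakk> \<Longrightarrow> (c \<odot> x) \<otimes> y = c \<odot> (x \<otimes> y)"
    and smult_mult_right: "\<lbrakk>x \<in> carrier A; y \<in> carrier A\<rbrakk> \<Longrightarrow> x \<otimes> (c \<odot> y) = c \<odot> (x \<otimes> y)"
    and anorm_mult: "\<lbrakk>x \<in> carrier A; y \<in> carrier A\<rbrakk> \<Longrightarrow> anorm A (x \<otimes> y) \<le> anorm A x * anorm A y"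

section \<open>Scalar arithmetic in complex normed spaces\<close>

context complex_normed_space
begin

lemma scale_closed [simp]: "x \<in> carrier V \<Longrightarrow> c \<odot> x \<in> carrier V"
  using smult_closed[of c x] by (simp add: complex_field_def)

lemma scale_add_left: "x \<in> carrier V \<Longrightarrow> (c + d) \<odot> x = c \<odot> x \<oplus> d \<odot> x"
  using smult_l_distr[of c d x] by (simp add: complex_field_def)

lemma scale_add_right: "x \<in> carrier V \<Longrightarrow> y \<in> carrier V \<Longrightarrow> c \<odot> (x \<oplus> y) = c \<odot> x \<oplus> c \<odot> y"
  using smult_r_distr[of c x y] by (simp add: complex_field_def)

lemma scale_scale: "x \<in> carrier V \<Longrightarrow> c \<odot> (d \<odot> x) = (c * d) \<odot> x"
  using smult_assoc1[of c d x] by (simp add: complex_field_def)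

lemma scale_one [simp]: "x \<in> carrier V \<Longrightarrow> 1 \<odot> x = x"
  using smult_one[of x] by (simp add: complex_field_def)

lemma scale_zero_left [simp]: "x \<in> carrier V \<Longrightarrow> 0 \<odot> x = \<zero>"
  using smult_l_null[of x] by (simp add: complex_field_def)

lemma scale_zero_right [simp]: "c \<odot> \<zero> = \<zero>"
  using smult_r_null[of c] by (simp add: complex_field_def)

lemma uminus_eq_scale: "x \<in> carrier V \<Longrightarrow> \<ominus> x = (-1) \<odot> x"
  using scale_add_left[of x "-1" 1] M.minus_equality[of "(-1) \<odot> x" x] by simp

lemma minus_eq_zero_iff: "x \<in> carrier V \<Longrightarrow> y \<in> carrier V \<Longrightarrow> x \<ominus> y = \<zero> \<longleftrightarrow> x = y"
  using M.minus_equality[of x "\<ominus> y"] by (auto simp: a_minus_def M.r_neg)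

lemma scale_minus_left: "x \<in> carrier V \<Longrightarrow> (- c) \<odot> x = \<ominus> (c \<odot> x)"
  by (simp add: uminus_eq_scale scale_scale)

lemma norm_zero [simp]: "N \<zero> = 0"
  using norm_eq_zero[of \<zero>] by simp

end

section \<open>Bounded functionals, derivations and the transfer principle\<close>

lemma dual_spaceI:
  assumes "\<And>x y. \<lbrakk>x \<in> carrier A; y \<in> carrier A\<rbrakk> \<Longrightarrow> \<phi> (x \<oplus>\<^bsub>A\<^esub> y) = \<phi> x + \<phi> y"
    and "\<And>c x. x \<in> carrier A \<Longrightarrow> \<phi> (c \<odot>\<^bsub>A\<^esub> x) = c * \<phi> x"
    and "\<And>x. x \<in> carrier A \<Longrightarrow> cmod (\<phi> x) \<le> K * anorm A x"
  shows "\<phi> \<in> dual_space A"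
  unfolding dual_space_def linear_maps_def complex_field_def
  using assms by (auto intro!: exI[of _ K])

lemma dual_space_add:
  "\<lbrakk>\<phi> \<in> dual_space A; x \<in> carrier A; y \<in> carrier A\<rbrakk> \<Longrightarrow> \<phi> (x \<oplus>\<^bsub>A\<^esub> y) = \<phi> x + \<phi> y"
  by (auto simp: dual_space_def linear_maps_def complex_field_def)

lemma dual_space_scale:
  "\<lbrakk>\<phi> \<in> dual_space A; x \<in> carrier A\<rbrakk> \<Longrightarrow> \<phi> (c \<odot>\<^bsub>A\<^esub> x) = c * \<phi> x"
  by (auto simp: dual_space_def linear_maps_def complex_field_def)

lemma dual_space_bounded:
  assumes "\<phi> \<in> dual_space A" "\<And>x. x \<in> carrier A \<Longrightarrow> 0 \<le> anorm A x"
  obtains K where "K \<ge> 0" "\<And>x. x \<in> carrier A \<Longrightarrow> cmod (\<phi> x) \<le> K * anorm A x"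
proof -
  obtain K where K: "\<And>x. x \<in> carrier A \<Longrightarrow> cmod (\<phi> x) \<le> K * anorm A x"
    using assms(1) by (auto simp: dual_space_def)
  have "cmod (\<phi> x) \<le> max K 0 * anorm A x" if "x \<in> carrier A" for x
    using K[OF that] mult_right_mono[of K "max K 0" "anorm A x"] assms(2)[OF that] by simp
  then show ?thesis using that[of "max K 0"] by simp
qed

lemma derivation_closed: "\<lbrakk>derivation A D; x \<in> carrier A\<rbrakk> \<Longrightarrow> D x \<in> carrier A"
  by (auto simp: derivation_def linear_maps_def)

lemma derivation_add:
  "\<lbrakk>derivation A D; x \<in> carrier A; y \<in> carrier A\<rbrakk> \<Longrightarrow> D (x \<oplus>\<^bsub>A\<^esub> y) = D x \<oplus>\<^bsub>A\<^esub> D y"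
  by (auto simp: derivation_def linear_maps_def)

lemma derivation_scale: "\<lbrakk>derivation A D; x \<in> carrier A\<rbrakk> \<Longrightarrow> D (c \<odot>\<^bsub>A\<^esub> x) = c \<odot>\<^bsub>A\<^esub> D x"
  by (auto simp: derivation_def linear_maps_def)

lemma derivation_mult:
  "\<lbrakk>derivation A D; x \<in> carrier A; y \<in> carrier A\<rbrakk>
    \<Longrightarrow> D (x \<otimes>\<^bsub>A\<^esub> y) = D x \<otimes>\<^bsub>A\<^esub> y \<oplus>\<^bsub>A\<^esub> x \<otimes>\<^bsub>A\<^esub> D y"
  by (auto simp: derivation_def)

lemma w2ld_closed: "\<lbrakk>weak_2_local_derivation A \<Delta>; x \<in> carrier A\<rbrakk> \<Longrightarrow> \<Delta> x \<in> carrier A"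
  by (auto simp: weak_2_local_derivation_def)

text \<open>For the given \<open>\<phi>\<close> some derivation agrees with \<open>\<Delta>\<close>
  at both points, so an identity between two values that all derivations satisfy passes to
  \<open>\<Delta>\<close>. The two-point hypothesis mostly enters in this form.\<close>

lemma w2ld_transfer:
  assumes "weak_2_local_derivation A \<Delta>" "\<phi> \<in> dual_space A" "x \<in> carrier A" "y \<in> carrier A"
    and "\<And>D. derivation A D \<Longrightarrow> \<phi> (D x) = \<phi> (D y)"
  shows "\<phi> (\<Delta> x) = \<phi> (\<Delta> y)"
  using assms unfolding weak_2_local_derivation_def by metis

lemma w2ld_transfer_zero:
  assumes "weak_2_local_derivation A \<Delta>" "\<phi> \<in> dual_space A" "x \<in> carrier A"
    and "\<And>D. derivation A D \<Longrightarrow> \<phi> (D x) = 0"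
  shows "\<phi> (\<Delta> x) = 0"
  using assms unfolding weak_2_local_derivation_def by metis

text \<open>The corner pAp is one-dimensional. The notion is purely algebraic, so bijective linear
  multiplicative maps carry it over.\<close>

definition minimal_idempotent :: "'a star_algebra \<Rightarrow> 'a \<Rightarrow> bool" where
  "minimal_idempotent A p \<longleftrightarrow>
    p \<in> carrier A \<and> p \<noteq> \<zero>\<^bsub>A\<^esub> \<and> p \<otimes>\<^bsub>A\<^esub> p = p \<and>
    (\<forall>x\<in>carrier A. \<exists>c. p \<otimes>\<^bsub>A\<^esub> (x \<otimes>\<^bsub>A\<^esub> p) = c \<odot>\<^bsub>A\<^esub> p)"

text \<open>For the projection onto a unit vector \<xi> of a Hilbert space this is the vector
  functional taking an operator T to \<open>cinner H (T \<xi>) \<xi>\<close>.\<close>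

definition corner_coeff :: "'a star_algebra \<Rightarrow> 'a \<Rightarrow> 'a \<Rightarrow> complex" where
  "corner_coeff A p x = (THE c. p \<otimes>\<^bsub>A\<^esub> (x \<otimes>\<^bsub>A\<^esub> p) = c \<odot>\<^bsub>A\<^esub> p)"

definition separated_by_minimal_idempotents :: "'a star_algebra \<Rightarrow> bool" where
  "separated_by_minimal_idempotents A \<longleftrightarrow>
    (\<forall>x\<in>carrier A. (\<forall>p. minimal_idempotent A p \<longrightarrow> p \<otimes>\<^bsub>A\<^esub> (x \<otimes>\<^bsub>A\<^esub> p) = \<zero>\<^bsub>A\<^esub>) \<longrightarrow> x = \<zero>\<^bsub>A\<^esub>)"

context unital_normed_algebra
begin

lemma derivation_zero: "derivation A D \<Longrightarrow> D \<zero> = \<zero>"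
  using derivation_scale[of A D \<zero> 0] derivation_closed[of A D \<zero>] by simp

lemma derivation_one: "derivation A D \<Longrightarrow> D \<one> = \<zero>"
  using derivation_mult[of A D \<one> \<one>] derivation_closed[of A D \<one>] by simp

lemma dual_zero: "\<phi> \<in> dual_space A \<Longrightarrow> \<phi> \<zero> = 0"
  using dual_space_scale[of \<phi> A \<zero> 0] by simp

lemma dual_uminus: "\<lbrakk>\<phi> \<in> dual_space A; x \<in> carrier A\<rbrakk> \<Longrightarrow> \<phi> (\<ominus> x) = - \<phi> x"
  by (simp add: uminus_eq_scale dual_space_scale)

lemma dual_diff:
  "\<lbrakk>\<phi> \<in> dual_space A; x \<in> carrier A; y \<in> carrier A\<rbrakk> \<Longrightarrow> \<phi> (x \<ominus> y) = \<phi> x - \<phi> y"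
  by (simp add: a_minus_def dual_uminus dual_space_add)

lemmas dual_simps = dual_space_add dual_space_scale dual_zero dual_uminus dual_diff

lemma dual_plus:
  assumes "\<phi> \<in> dual_space A" "\<psi> \<in> dual_space A"
  shows "(\<lambda>x. \<phi> x + \<psi> x) \<in> dual_space A"
proof -
  obtain K L where "\<And>x. x \<in> carrier A \<Longrightarrow> cmod (\<phi> x) \<le> K * anorm A x"
      "\<And>x. x \<in> carrier A \<Longrightarrow> cmod (\<psi> x) \<le> L * anorm A x"
    using assms by (auto simp: dual_space_def)
  then show ?thesis
    using assms
    by (intro dual_spaceI[where K = "K + L"])
       (auto simp: dual_simps algebra_simps intro: order.trans[OF norm_triangle_ineq] add_mono)
qed

text \<open>Testing a product with \<open>\<Delta> a\<close> in the middle against one functional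
  amounts to testing \<open>\<Delta> a\<close> itself against another.\<close>

lemma dual_mult:
  assumes "\<phi> \<in> dual_space A" and u: "u \<in> carrier A" and v: "v \<in> carrier A"
  shows "(\<lambda>x. \<phi> (u \<otimes> (x \<otimes> v))) \<in> dual_space A"
proof -
  obtain K where K: "K \<ge> 0" "\<And>x. x \<in> carrier A \<Longrightarrow> cmod (\<phi> x) \<le> K * anorm A x"
    using dual_space_bounded[OF assms(1)] norm_nonneg by metis
  have "cmod (\<phi> (u \<otimes> (x \<otimes> v))) \<le> (K * anorm A u * anorm A v) * anorm A x" if x: "x \<in> carrier A" for x
  proof -
    have "anorm A (u \<otimes> (x \<otimes> v)) \<le> anorm A u * anorm A (x \<otimes> v)"
      using u v x by (intro anorm_mult) auto
    also have "\<dots> \<le> anorm A u * (anorm A x * anorm A v)"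
      using u v x by (intro mult_left_mono anorm_mult norm_nonneg) auto
    finally have "K * anorm A (u \<otimes> (x \<otimes> v)) \<le> K * (anorm A u * (anorm A x * anorm A v))"
      using K(1) by (rule mult_left_mono)
    then show ?thesis
      using K(2)[of "u \<otimes> (x \<otimes> v)"] u v x by (simp add: mult_ac)
  qed
  then show ?thesis
    using assms
    by (intro dual_spaceI)
       (auto simp: dual_simps l_distr r_distr smult_mult_left smult_mult_right)
qed

lemma corner_coeff_unique:
  assumes "p \<in> carrier A" "p \<noteq> \<zero>" "c \<odot> p = d \<odot> p"
  shows "c = d"
proof -
  have "(c - d) \<odot> p = \<zero>"
    using assms scale_add_left[of p c "-d"] by (simp add: scale_minus_left r_neg)
  then have "cmod (c - d) * anorm A p = 0"
    using norm_smult[OF assms(1), of "c - d"] by simp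
  then show ?thesis
    using norm_eq_zero assms by simp
qed

lemma corner_coeffI:
  assumes "minimal_idempotent A p" "p \<otimes> (x \<otimes> p) = c \<odot> p"
  shows "corner_coeff A p x = c"
  unfolding corner_coeff_def
  using assms corner_coeff_unique by (intro the_equality) (auto simp: minimal_idempotent_def)

lemma minimal_idempotent_closed: "minimal_idempotent A p \<Longrightarrow> p \<in> carrier A"
  by (auto simp: minimal_idempotent_def)

lemma corner_eq:
  assumes "minimal_idempotent A p" "x \<in> carrier A"
  shows "p \<otimes> (x \<otimes> p) = corner_coeff A p x \<odot> p"
  using assms corner_coeffI[OF assms(1)] unfolding minimal_idempotent_def by metis

text \<open>Since pxp has norm at most ||p||^2 ||x||, dividing by ||p|| > 0 gives boundedness. The
  coefficient thereby becomes an admissible test functional for a weak-2-local derivation.\<close>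

lemma corner_coeff_dual:
  assumes "minimal_idempotent A p"
  shows "corner_coeff A p \<in> dual_space A"
proof (rule dual_spaceI)
  have p: "p \<in> carrier A" "p \<noteq> \<zero>" using assms by (auto simp: minimal_idempotent_def)
  note eq = corner_eq[OF assms]
  fix x c assume x: "x \<in> carrier A"
  show "corner_coeff A p (c \<odot> x) = c * corner_coeff A p x"
    using p x by (intro corner_coeffI[OF assms]) (simp add: smult_mult_left smult_mult_right eq scale_scale)
  have "anorm A p > 0" using p norm_eq_zero norm_nonneg by (metis order_le_less)
  have "cmod (corner_coeff A p x) * anorm A p = anorm A (p \<otimes> (x \<otimes> p))"
    using p x by (simp add: eq norm_smult)
  also have "\<dots> \<le> anorm A p * anorm A (x \<otimes> p)"
    using p x by (intro anorm_mult) auto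
  also have "\<dots> \<le> anorm A p * (anorm A x * anorm A p)"
    using p x by (intro mult_left_mono anorm_mult norm_nonneg) auto
  also have "\<dots> = (anorm A p * anorm A x) * anorm A p"
    by simp
  finally show "cmod (corner_coeff A p x) \<le> anorm A p * anorm A x"
    using \<open>anorm A p > 0\<close> by (simp add: mult.commute)
  fix y assume y: "y \<in> carrier A"
  show "corner_coeff A p (x \<oplus> y) = corner_coeff A p x + corner_coeff A p y"
    using p x y by (intro corner_coeffI[OF assms]) (simp add: l_distr r_distr eq scale_add_left)
qed

end

locale atomic_algebra = unital_normed_algebra +
  assumes separated: "separated_by_minimal_idempotents A"
begin

lemma corner_coeff_separates:
  assumes "x \<in> carrier A" "y \<in> carrier A"
    and "\<And>p. minimal_idempotent A p \<Longrightarrow> corner_coeff A p x = corner_coeff A p y"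
  shows "x = y"
proof -
  have "p \<otimes> ((x \<ominus> y) \<otimes> p) = \<zero>" if p: "minimal_idempotent A p" for p
    using corner_eq[OF p, of "x \<ominus> y"] corner_coeff_dual[OF p] minimal_idempotent_closed[OF p] assms p
    by (simp add: dual_simps)
  then have "x \<ominus> y = \<zero>"
    using separated assms unfolding separated_by_minimal_idempotents_def by simp
  then show ?thesis using assms by (simp add: minus_eq_zero_iff)
qed

text \<open>The coefficient functionals of minimal idempotents alone already separate points, so
  equalities in the algebra reduce to scalar ones.\<close>

lemma dual_separates:
  assumes "x \<in> carrier A" "y \<in> carrier A"
    and "\<And>\<phi>. \<phi> \<in> dual_space A \<Longrightarrow> \<phi> x = \<phi> y"
  shows "x = y"
  using assms corner_coeff_dual by (intro corner_coeff_separates) auto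

end

section \<open>Derivations compressed by one minimal idempotent\<close>

locale minimal_corner = unital_normed_algebra +
  fixes p
  assumes minimal: "minimal_idempotent A p"
begin

abbreviation "\<tau> \<equiv> corner_coeff A p"

lemma p_closed [simp]: "p \<in> carrier A"
  and p_idem [simp]: "p \<otimes> p = p"
  using minimal by (auto simp: minimal_idempotent_def)

lemma p_idem_left [simp]: "x \<in> carrier A \<Longrightarrow> p \<otimes> (p \<otimes> x) = p \<otimes> x"
  by (simp flip: m_assoc)

lemma tau_dual: "\<tau> \<in> dual_space A"
  by (rule corner_coeff_dual[OF minimal])

lemmas tau_linear [simp] = dual_simps[OF tau_dual]

lemma tau_p_left [simp]: "x \<in> carrier A \<Longrightarrow> \<tau> (p \<otimes> x) = \<tau> x"
  by (rule corner_coeffI[OF minimal]) (simp add: m_assoc corner_eq[OF minimal] smult_mult_right)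

lemma tau_p_right [simp]: "x \<in> carrier A \<Longrightarrow> \<tau> (x \<otimes> p) = \<tau> x"
  by (rule corner_coeffI[OF minimal]) (simp add: m_assoc corner_eq[OF minimal] smult_mult_right)

lemma tau_p [simp]: "\<tau> p = 1"
  by (rule corner_coeffI[OF minimal]) simp

lemma tau_p_right2 [simp]: "x \<in> carrier A \<Longrightarrow> y \<in> carrier A \<Longrightarrow> \<tau> (x \<otimes> (y \<otimes> p)) = \<tau> (x \<otimes> y)"
  by (simp flip: m_assoc)

text \<open>Since \<open>p\<close> is idempotent, pxpyp is the product of the corners pxp and pyp,
  both multiples of \<open>p\<close>.\<close>

lemma tau_mult_p_mult [simp]:
  assumes "x \<in> carrier A" "y \<in> carrier A"
  shows "\<tau> (x \<otimes> (p \<otimes> y)) = \<tau> x * \<tau> y"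
proof (rule corner_coeffI[OF minimal])
  have "p \<otimes> (x \<otimes> (p \<otimes> y) \<otimes> p) = (p \<otimes> (x \<otimes> p)) \<otimes> (p \<otimes> (y \<otimes> p))"
    using assms by (simp add: m_assoc)
  also have "\<dots> = (\<tau> x * \<tau> y) \<odot> p"
    using assms by (simp add: corner_eq[OF minimal] smult_mult_left smult_mult_right scale_scale mult.commute)
  finally show "p \<otimes> (x \<otimes> (p \<otimes> y) \<otimes> p) = (\<tau> x * \<tau> y) \<odot> p" .
qed

lemma tau_mult_mult_p_mult [simp]:
  "\<lbrakk>x \<in> carrier A; y \<in> carrier A; z \<in> carrier A\<rbrakk> \<Longrightarrow> \<tau> (x \<otimes> (y \<otimes> (p \<otimes> z))) = \<tau> (x \<otimes> y) * \<tau> z"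
  using tau_mult_p_mult[of "x \<otimes> y" z] by (simp add: m_assoc)

text \<open>Applying \<tau> to D(p) = D(p)p + pD(p) yields \<tau>(D(p)) = 2 \<tau>(D(p)).\<close>

lemma tau_derivation_p:
  assumes "derivation A D" shows "\<tau> (D p) = 0"
  using arg_cong[OF derivation_mult[OF assms p_closed p_closed], of \<tau>] derivation_closed[OF assms]
  by simp

text \<open>Differentiate pxp = \<tau>(x)p and apply \<tau>; the multiple of D(p) on the right
  contributes nothing.\<close>

lemma tau_derivation:
  assumes D: "derivation A D" and x: "x \<in> carrier A"
  shows "\<tau> (D x) = - (\<tau> (D p \<otimes> x) + \<tau> (x \<otimes> D p))"
proof -
  note [simp] = derivation_closed[OF D]
  have "0 = \<tau> (D (p \<otimes> (x \<otimes> p)))"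
    using x by (simp add: corner_eq[OF minimal] derivation_scale[OF D] tau_derivation_p[OF D])
  also have "\<dots> = \<tau> (D p \<otimes> x) + \<tau> (D x) + \<tau> (x \<otimes> D p)"
    using x by (simp add: derivation_mult[OF D] r_distr)
  finally show ?thesis by (simp add: algebra_simps eq_neg_iff_add_eq_0)
qed

text \<open>This is pa(1 - p) + (1 - p)ap, the sum of the two off-diagonal Peirce components of
  \<open>a\<close>.\<close>

definition "off_diagonal a = p \<otimes> a \<oplus> a \<otimes> p \<ominus> (2 * \<tau> a) \<odot> p"

lemma off_diagonal_closed [simp]: "a \<in> carrier A \<Longrightarrow> off_diagonal a \<in> carrier A"
  by (simp add: off_diagonal_def)

text \<open>After expansion, every term other than \<tau>(xa), respectively \<tau>(ax), carries the
  factor \<open>\<tau> x\<close>.\<close>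

lemma tau_off_diagonal:
  assumes "a \<in> carrier A" "x \<in> carrier A" "\<tau> x = 0"
  shows "\<tau> (x \<otimes> off_diagonal a) = \<tau> (x \<otimes> a)" "\<tau> (off_diagonal a \<otimes> x) = \<tau> (a \<otimes> x)"
  using assms
  by (simp_all add: off_diagonal_def a_minus_def l_distr r_distr m_assoc smult_mult_left
      smult_mult_right l_minus r_minus)

lemma tau_derivation_off_diagonal:
  assumes D: "derivation A D" and a: "a \<in> carrier A"
  shows "\<tau> (D (off_diagonal a)) = \<tau> (D a)"
  using a by (simp add: tau_derivation[OF D] tau_off_diagonal derivation_closed[OF D] tau_derivation_p[OF D])

text \<open>With b = \<open>off_diagonal a\<close> the sum is \<tau>(D(b^2)). The square b^2 is
  diagonal, so pb^2 and b^2p are multiples of \<open>p\<close>, and the formula for \<tau>(D(x))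
  leaves only multiples of \<tau>(D(p)) = 0.\<close>

lemma tau_derivation_off_diagonal_square:
  assumes D: "derivation A D" and a: "a \<in> carrier A"
  shows "\<tau> (D (off_diagonal a) \<otimes> off_diagonal a) + \<tau> (off_diagonal a \<otimes> D (off_diagonal a)) = 0"
proof -
  note [simp] = derivation_closed[OF D]
  have "\<tau> (D (off_diagonal a) \<otimes> off_diagonal a) + \<tau> (off_diagonal a \<otimes> D (off_diagonal a))
      = \<tau> (D (off_diagonal a \<otimes> off_diagonal a))"
    using a by (simp add: derivation_mult[OF D])
  also have "\<dots> = - (\<tau> (D p \<otimes> (off_diagonal a \<otimes> off_diagonal a)) + \<tau> (off_diagonal a \<otimes> (off_diagonal a \<otimes> D p)))"
    using a by (subst tau_derivation[OF D]) (simp_all add: m_assoc)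
  also have "\<dots> = 0"
    using a tau_derivation_p[OF D]
    by (simp add: off_diagonal_def a_minus_def l_distr r_distr m_assoc smult_mult_left
      smult_mult_right l_minus r_minus)
  finally show ?thesis .
qed

text \<open>Each link of the chain compares at most two points under one functional, which is why it
  passes through \<open>b \<oplus> p\<close>. On the right of the resulting formula
  \<open>\<Delta>\<close> occurs only at the fixed element \<open>p\<close>, which forces
  \<open>\<tau> (\<Delta> a)\<close> to depend linearly on \<open>a\<close>.\<close>

lemma tau_w2ld:
  assumes \<Delta>: "weak_2_local_derivation A \<Delta>" and a: "a \<in> carrier A"
  shows "\<tau> (\<Delta> a) = - (\<tau> (\<Delta> p \<otimes> a) + \<tau> (a \<otimes> \<Delta> p))"
proof -
  define b where "b = off_diagonal a"
  define \<phi> where "\<phi> x = \<tau> (x \<otimes> b) + \<tau> (b \<otimes> x)" for x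
  have b [simp]: "b \<in> carrier A" using a by (simp add: b_def)
  note [simp] = derivation_closed derivation_add w2ld_closed[OF \<Delta>]
  have \<phi>: "\<phi> \<in> dual_space A"
  proof -
    \<comment> \<open>Factors \<open>\<one>\<close> bring both summands of \<phi> into the form
      covered by \<open>dual_mult\<close>.\<close>
    have "(\<lambda>x. \<tau> (\<one> \<otimes> (x \<otimes> b)) + \<tau> (b \<otimes> (x \<otimes> \<one>))) \<in> dual_space A"
      by (intro dual_plus dual_mult tau_dual) auto
    then show ?thesis
      by (simp add: \<phi>_def dual_space_def linear_maps_def complex_field_def)
  qed
  have \<phi>b: "\<phi> (D b) = 0" if "derivation A D" for D
    using tau_derivation_off_diagonal_square[OF that a] by (simp add: \<phi>_def b_def)
  have \<phi>p: "\<phi> (D p) = - \<tau> (D b)" if "derivation A D" for D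
    using tau_derivation[OF that b] by (simp add: \<phi>_def)
  have "\<tau> (\<Delta> a) = \<tau> (\<Delta> b)"
    using a by (intro w2ld_transfer[OF \<Delta> tau_dual]) (auto simp: b_def tau_derivation_off_diagonal)
  also have "\<dots> = \<tau> (\<Delta> (b \<oplus> p))"
    by (intro w2ld_transfer[OF \<Delta> tau_dual]) (auto simp: tau_derivation_p)
  \<comment> \<open>For a derivation, \<phi>(D(p)) = -\<tau>(D(b)) cancels \<tau>(D(b)), the only
    other surviving term, so \<phi> + \<tau> vanishes on D(b + p).\<close>
  also have "\<dots> = - \<phi> (\<Delta> (b \<oplus> p))"
    using w2ld_transfer_zero[OF \<Delta> dual_plus[OF \<phi> tau_dual], of "b \<oplus> p"]
    by (simp add: \<phi>b \<phi>p dual_simps[OF \<phi>] tau_derivation_p eq_neg_iff_add_eq_0 add.commute)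
  also have "\<phi> (\<Delta> (b \<oplus> p)) = \<phi> (\<Delta> p)"
    by (intro w2ld_transfer[OF \<Delta> \<phi>]) (auto simp: \<phi>b dual_simps[OF \<phi>])
  also have "\<tau> (\<Delta> p) = 0"
    by (intro w2ld_transfer_zero[OF \<Delta> tau_dual]) (auto simp: tau_derivation_p)
  \<comment> \<open>The vanishing of \<open>\<tau> (\<Delta> p)\<close> allows \<open>b\<close> to
    be replaced by \<open>a\<close> inside \<phi>.\<close>
  then have "\<phi> (\<Delta> p) = \<tau> (\<Delta> p \<otimes> a) + \<tau> (a \<otimes> \<Delta> p)"
    using a by (simp add: \<phi>_def b_def tau_off_diagonal)
  finally show ?thesis .
qed

end

section \<open>Linearity and the Leibniz rule in an algebra separated by minimal idempotents\<close>

locale atomic_w2ld = atomic_algebra +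
  fixes \<Delta>
  assumes w2ld: "weak_2_local_derivation A \<Delta>"
begin

lemmas \<Delta>_closed [simp] = w2ld_closed[OF w2ld]

lemma \<Delta>_add:
  assumes [simp]: "x \<in> carrier A" "y \<in> carrier A" shows "\<Delta> (x \<oplus> y) = \<Delta> x \<oplus> \<Delta> y"
proof (rule corner_coeff_separates)
  fix p assume "minimal_idempotent A p"
  then interpret minimal_corner A p by unfold_locales
  show "\<tau> (\<Delta> (x \<oplus> y)) = \<tau> (\<Delta> x \<oplus> \<Delta> y)"
    by (simp add: tau_w2ld[OF w2ld] l_distr r_distr)
qed auto

text \<open>For each functional a single derivation serves the pair \<open>c \<odot> x\<close> and
  \<open>x\<close>, so homogeneity is inherited directly.\<close>

lemma \<Delta>_scale:
  assumes [simp]: "x \<in> carrier A" shows "\<Delta> (c \<odot> x) = c \<odot> \<Delta> x"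
proof (rule dual_separates)
  fix \<phi> assume \<phi>: "\<phi> \<in> dual_space A"
  then obtain D where "derivation A D" "\<phi> (\<Delta> (c \<odot> x)) = \<phi> (D (c \<odot> x))" "\<phi> (\<Delta> x) = \<phi> (D x)"
    using w2ld unfolding weak_2_local_derivation_def by (metis assms scale_closed)
  then show "\<phi> (\<Delta> (c \<odot> x)) = \<phi> (c \<odot> \<Delta> x)"
    by (simp add: derivation_scale derivation_closed dual_simps[OF \<phi>])
qed auto

lemma \<Delta>_diff: "\<lbrakk>x \<in> carrier A; y \<in> carrier A\<rbrakk> \<Longrightarrow> \<Delta> (x \<ominus> y) = \<Delta> x \<ominus> \<Delta> y"
  by (simp add: a_minus_def uminus_eq_scale \<Delta>_add \<Delta>_scale)

lemma \<Delta>_one: "\<Delta> \<one> = \<zero>"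
  by (intro dual_separates w2ld_transfer_zero[OF w2ld])
     (auto simp: dual_zero derivation_one intro: w2ld_transfer_zero[OF w2ld])

text \<open>From xa = 0 a derivation satisfies xD(a) = -D(x)a, and multiplying by \<open>y\<close>
  on the right gives zero because ay = 0. Only one value of \<open>\<Delta>\<close> is involved, so
  the conclusion transfers.\<close>

lemma \<Delta>_zero_products:
  assumes [simp]: "a \<in> carrier A" "x \<in> carrier A" "y \<in> carrier A"
    and "x \<otimes> a = \<zero>" "a \<otimes> y = \<zero>"
  shows "x \<otimes> (\<Delta> a \<otimes> y) = \<zero>"
proof (rule dual_separates)
  fix \<phi> assume \<phi>: "\<phi> \<in> dual_space A"
  have "x \<otimes> (D a \<otimes> y) = \<zero>" if D: "derivation A D" for D
  proof -
    note [simp] = derivation_closed[OF D]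
    have "\<zero> = (D x \<otimes> a \<oplus> x \<otimes> D a) \<otimes> y"
      using derivation_mult[OF D, of x a, symmetric] by (simp add: assms(4) derivation_zero[OF D])
    then show ?thesis by (simp add: l_distr m_assoc assms(5))
  qed
  then have "\<phi> (x \<otimes> (\<Delta> a \<otimes> y)) = 0"
    by (intro w2ld_transfer_zero[OF w2ld dual_mult[OF \<phi>]]) (auto simp: dual_zero[OF \<phi>])
  then show "\<phi> (x \<otimes> (\<Delta> a \<otimes> y)) = \<phi> \<zero>" by (simp add: dual_zero[OF \<phi>])
qed auto

text \<open>Split \<open>y\<close> as ye + y(1 - e). The zero-product rule with right factors 1 - e
  and e gives q\<Delta>(ye)(1 - e) = 0 and q\<Delta>(y(1 - e))e = 0, and linearity combines the
  two.\<close>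

lemma \<Delta>_mult_idempotent:
  assumes [simp]: "q \<in> carrier A" "e \<in> carrier A" "y \<in> carrier A" "q \<otimes> y = \<zero>" "e \<otimes> e = e"
  shows "q \<otimes> \<Delta> (y \<otimes> e) = q \<otimes> (\<Delta> y \<otimes> e)"
proof -
  have *: "q \<otimes> (y \<otimes> z) = \<zero>" if "z \<in> carrier A" for z
    using that by (simp flip: m_assoc)
  have "q \<otimes> (\<Delta> (y \<otimes> e) \<otimes> (\<one> \<ominus> e)) = \<zero>"
    by (rule \<Delta>_zero_products)
       (auto simp: a_minus_def r_distr r_minus m_assoc r_neg *)
  moreover have "q \<otimes> (\<Delta> (y \<otimes> (\<one> \<ominus> e)) \<otimes> e) = \<zero>"
    by (rule \<Delta>_zero_products)
       (auto simp: a_minus_def l_distr r_distr l_minus r_minus m_assoc r_neg *)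
  moreover have "y \<otimes> (\<one> \<ominus> e) = y \<ominus> y \<otimes> e"
    by (simp add: a_minus_def r_distr r_minus)
  moreover have "q \<otimes> (\<Delta> (y \<otimes> e) \<otimes> (\<one> \<ominus> e)) = q \<otimes> \<Delta> (y \<otimes> e) \<ominus> q \<otimes> (\<Delta> (y \<otimes> e) \<otimes> e)"
    by (simp add: a_minus_def r_distr r_minus)
  moreover have "q \<otimes> (\<Delta> (y \<ominus> y \<otimes> e) \<otimes> e) = q \<otimes> (\<Delta> y \<otimes> e) \<ominus> q \<otimes> (\<Delta> (y \<otimes> e) \<otimes> e)"
    by (simp add: \<Delta>_diff) (simp add: a_minus_def l_distr r_distr r_minus l_minus)
  ultimately show ?thesis
    by (simp add: minus_eq_zero_iff)
qed

text \<open>This is the Leibniz rule for vxw after the terms with \<open>\<Delta> v\<close> and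
  \<open>\<Delta> w\<close> have been eliminated. It is linear in each of \<open>v\<close> and
  \<open>w\<close>, so it spreads from idempotents to their combinations.\<close>

definition "splits v w \<longleftrightarrow>
  (\<forall>x\<in>carrier A. \<Delta> (v \<otimes> (x \<otimes> w)) \<oplus> v \<otimes> (\<Delta> x \<otimes> w) = \<Delta> (v \<otimes> x) \<otimes> w \<oplus> v \<otimes> \<Delta> (x \<otimes> w))"

text \<open>The element x - qx is annihilated on the left by \<open>q\<close>, and qx by 1 - q.
  \<open>\<Delta>_mult_idempotent\<close> applies to both pieces, and the difference of the two
  results is the claim.\<close>

lemma splits_idempotents:
  assumes [simp]: "q \<in> carrier A" "e \<in> carrier A" "q \<otimes> q = q" "e \<otimes> e = e"
  shows "splits q e"
  unfolding splits_def
proof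
  fix x assume [simp]: "x \<in> carrier A"
  have q: "q \<otimes> (q \<otimes> z) = q \<otimes> z" if "z \<in> carrier A" for z
    using that by (simp flip: m_assoc)
  have 1: "q \<otimes> \<Delta> (x \<otimes> e \<ominus> q \<otimes> (x \<otimes> e)) = q \<otimes> (\<Delta> (x \<ominus> q \<otimes> x) \<otimes> e)"
    using \<Delta>_mult_idempotent[of q e "x \<ominus> q \<otimes> x"]
    by (simp add: a_minus_def l_distr r_distr l_minus r_minus m_assoc r_neg q)
  have 2: "(\<one> \<ominus> q) \<otimes> \<Delta> (q \<otimes> (x \<otimes> e)) = (\<one> \<ominus> q) \<otimes> (\<Delta> (q \<otimes> x) \<otimes> e)"
    using \<Delta>_mult_idempotent[of "\<one> \<ominus> q" e "q \<otimes> x"]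
    by (simp add: a_minus_def l_distr r_distr l_minus r_minus m_assoc r_neg q)
  show "\<Delta> (q \<otimes> (x \<otimes> e)) \<oplus> q \<otimes> (\<Delta> x \<otimes> e) = \<Delta> (q \<otimes> x) \<otimes> e \<oplus> q \<otimes> \<Delta> (x \<otimes> e)"
  \<comment> \<open>Functionals turn both identities into complex equations, which combine by linear
    arithmetic on real and imaginary parts.\<close>
  proof (rule dual_separates)
    fix \<phi> assume \<phi>: "\<phi> \<in> dual_space A"
    show "\<phi> (\<Delta> (q \<otimes> (x \<otimes> e)) \<oplus> q \<otimes> (\<Delta> x \<otimes> e)) = \<phi> (\<Delta> (q \<otimes> x) \<otimes> e \<oplus> q \<otimes> \<Delta> (x \<otimes> e))"
      using arg_cong[OF 1, of \<phi>] arg_cong[OF 2, of \<phi>]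
      by ((simp add: \<Delta>_diff), (simp add: a_minus_def l_distr r_distr l_minus r_minus dual_simps[OF \<phi>]),
          simp add: complex_eq_iff)
  qed auto
qed

lemma splits_combination_left:
  assumes "splits v w" "splits v' w" and [simp]: "v \<in> carrier A" "v' \<in> carrier A" "w \<in> carrier A"
  shows "splits (c \<odot> v \<oplus> c' \<odot> v') w"
  unfolding splits_def
proof
  fix x assume [simp]: "x \<in> carrier A"
  note eqs = assms(1,2)[unfolded splits_def, rule_format, of x, simplified]
  show "\<Delta> ((c \<odot> v \<oplus> c' \<odot> v') \<otimes> (x \<otimes> w)) \<oplus> (c \<odot> v \<oplus> c' \<odot> v') \<otimes> (\<Delta> x \<otimes> w) =
      \<Delta> ((c \<odot> v \<oplus> c' \<odot> v') \<otimes> x) \<otimes> w \<oplus> (c \<odot> v \<oplus> c' \<odot> v') \<otimes> \<Delta> (x \<otimes> w)" (is "?l = ?r")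
  proof (rule dual_separates)
    fix \<phi> assume \<phi>: "\<phi> \<in> dual_space A"
    have "\<phi> ?l = c * \<phi> (\<Delta> (v \<otimes> (x \<otimes> w)) \<oplus> v \<otimes> (\<Delta> x \<otimes> w)) + c' * \<phi> (\<Delta> (v' \<otimes> (x \<otimes> w)) \<oplus> v' \<otimes> (\<Delta> x \<otimes> w))"
      by (simp add: l_distr smult_mult_left \<Delta>_add \<Delta>_scale dual_simps[OF \<phi>] algebra_simps)
    also have "\<dots> = \<phi> ?r"
      unfolding eqs
      by (simp add: l_distr smult_mult_left \<Delta>_add \<Delta>_scale dual_simps[OF \<phi>] algebra_simps)
    finally show "\<phi> ?l = \<phi> ?r" .
  qed auto
qed

lemma splits_combination_right:
  assumes "splits v w" "splits v w'" and [simp]: "v \<in> carrier A" "w' \<in> carrier A" "w \<in> carrier A"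
  shows "splits v (c \<odot> w \<oplus> c' \<odot> w')"
  unfolding splits_def
proof
  fix x assume [simp]: "x \<in> carrier A"
  note eqs = assms(1,2)[unfolded splits_def, rule_format, of x, simplified]
  show "\<Delta> (v \<otimes> (x \<otimes> (c \<odot> w \<oplus> c' \<odot> w'))) \<oplus> v \<otimes> (\<Delta> x \<otimes> (c \<odot> w \<oplus> c' \<odot> w')) =
      \<Delta> (v \<otimes> x) \<otimes> (c \<odot> w \<oplus> c' \<odot> w') \<oplus> v \<otimes> \<Delta> (x \<otimes> (c \<odot> w \<oplus> c' \<odot> w'))" (is "?l = ?r")
  proof (rule dual_separates)
    fix \<phi> assume \<phi>: "\<phi> \<in> dual_space A"
    have "\<phi> ?l = c * \<phi> (\<Delta> (v \<otimes> (x \<otimes> w)) \<oplus> v \<otimes> (\<Delta> x \<otimes> w)) + c' * \<phi> (\<Delta> (v \<otimes> (x \<otimes> w')) \<oplus> v \<otimes> (\<Delta> x \<otimes> w'))"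
      by (simp add: r_distr smult_mult_right \<Delta>_add \<Delta>_scale dual_simps[OF \<phi>] algebra_simps)
    also have "\<dots> = \<phi> ?r"
      unfolding eqs
      by (simp add: r_distr smult_mult_right \<Delta>_add \<Delta>_scale dual_simps[OF \<phi>] algebra_simps)
    finally show "\<phi> ?l = \<phi> ?r" .
  qed auto
qed

text \<open>
  Writing \<open>pap = \<tau> p\<close>, the element \<open>pa / \<tau>\<close> is idempotent when \<open>\<tau> \<noteq> 0\<close>, and \<open>p + pa\<close> is when
  \<open>\<tau> = 0\<close>; likewise on the other side.
\<close>

lemma minimal_mult_eq_combination:
  assumes "minimal_idempotent A p" and [simp]: "a \<in> carrier A"
  obtains q r c d where "q \<in> carrier A" "r \<in> carrier A" "q \<otimes> q = q" "r \<otimes> r = r"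
    "p \<otimes> a = c \<odot> q \<oplus> d \<odot> r"
proof -
  interpret minimal_corner A p using assms(1) by unfold_locales
  have pp: "p \<otimes> (a \<otimes> (p \<otimes> a)) = \<tau> a \<odot> (p \<otimes> a)"
    using arg_cong[OF corner_eq[OF minimal, of a], of "\<lambda>z. z \<otimes> a"] by (simp add: m_assoc smult_mult_left)
  show ?thesis
  proof (cases "\<tau> a = 0")
    case True
    with corner_eq[OF minimal, of a] have 0: "p \<otimes> (a \<otimes> p) = \<zero>" by simp
    show ?thesis
      by (rule that[of "p \<oplus> p \<otimes> a" p 1 "-1"])
         (use True in \<open>simp_all add: l_distr r_distr m_assoc 0 pp scale_minus_left a_ac r_neg1 r_neg2\<close>)
  next
    case False
    then show ?thesis
      by (intro that[of "(1 / \<tau> a) \<odot> (p \<otimes> a)" \<zero> "\<tau> a" 0])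
         (simp_all add: smult_mult_left smult_mult_right m_assoc pp scale_scale)
  qed
qed

lemma mult_minimal_eq_combination:
  assumes "minimal_idempotent A p" and [simp]: "a \<in> carrier A"
  obtains q r c d where "q \<in> carrier A" "r \<in> carrier A" "q \<otimes> q = q" "r \<otimes> r = r"
    "a \<otimes> p = c \<odot> q \<oplus> d \<odot> r"
proof -
  interpret minimal_corner A p using assms(1) by unfold_locales
  have pp: "a \<otimes> (p \<otimes> (a \<otimes> p)) = \<tau> a \<odot> (a \<otimes> p)"
    by (simp add: corner_eq[OF minimal] smult_mult_right)
  show ?thesis
  proof (cases "\<tau> a = 0")
    case True
    with corner_eq[OF minimal, of a] have 0: "p \<otimes> (a \<otimes> p) = \<zero>" by simp
    show ?thesis
      by (rule that[of "p \<oplus> a \<otimes> p" p 1 "-1"])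
         (use True in \<open>simp_all add: l_distr r_distr m_assoc 0 pp scale_minus_left a_ac r_neg1 r_neg2\<close>)
  next
    case False
    then show ?thesis
      by (intro that[of "(1 / \<tau> a) \<odot> (a \<otimes> p)" \<zero> "\<tau> a" 0])
         (simp_all add: smult_mult_left smult_mult_right m_assoc pp scale_scale)
  qed
qed

lemma splits_minimal:
  assumes p: "minimal_idempotent A p" and [simp]: "a \<in> carrier A" "b \<in> carrier A"
  shows "splits (p \<otimes> a) (b \<otimes> p)"
proof -
  obtain q r c d where v: "q \<in> carrier A" "r \<in> carrier A" "q \<otimes> q = q" "r \<otimes> r = r"
    "p \<otimes> a = c \<odot> q \<oplus> d \<odot> r"
    using minimal_mult_eq_combination[OF p assms(2)] .
  obtain q' r' c' d' where w: "q' \<in> carrier A" "r' \<in> carrier A" "q' \<otimes> q' = q'" "r' \<otimes> r' = r'"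
    "b \<otimes> p = c' \<odot> q' \<oplus> d' \<odot> r'"
    using mult_minimal_eq_combination[OF p assms(3)] .
  show ?thesis
    unfolding v(5) w(5) using v(1-4) w(1-4)
    by (intro splits_combination_left splits_combination_right splits_idempotents) auto
qed

text \<open>\<open>splits\<close> is used at (v, x, w) = (pa, 1, bp), (p, ab, p), (p, a, bp), (pa,
  b, p), in this order. Under \<tau>, adding the last two equations and subtracting the first two
  cancels every term with a factor \<open>p\<close> under \<open>\<Delta>\<close>.\<close>

lemma \<Delta>_mult:
  assumes [simp]: "a \<in> carrier A" "b \<in> carrier A"
  shows "\<Delta> (a \<otimes> b) = \<Delta> a \<otimes> b \<oplus> a \<otimes> \<Delta> b"
proof (rule corner_coeff_separates)
  fix p assume p: "minimal_idempotent A p"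
  then interpret minimal_corner A p by unfold_locales
  note splits = splits_minimal[OF p, unfolded splits_def, rule_format]
  have "\<tau> (\<Delta> (p \<otimes> (a \<otimes> (b \<otimes> p)))) = \<tau> (\<Delta> (p \<otimes> a) \<otimes> b) + \<tau> (a \<otimes> \<Delta> (b \<otimes> p))"
    using arg_cong[OF splits[of a b \<one>], of \<tau>] by (simp add: \<Delta>_one m_assoc)
  moreover have "\<tau> (\<Delta> (p \<otimes> (a \<otimes> (b \<otimes> p)))) + \<tau> (\<Delta> (a \<otimes> b)) = \<tau> (\<Delta> (p \<otimes> (a \<otimes> b))) + \<tau> (\<Delta> (a \<otimes> (b \<otimes> p)))"
    using arg_cong[OF splits[of \<one> \<one> "a \<otimes> b"], of \<tau>] by (simp add: m_assoc)
  moreover have "\<tau> (\<Delta> (p \<otimes> (a \<otimes> (b \<otimes> p)))) + \<tau> (\<Delta> a \<otimes> b) = \<tau> (\<Delta> (p \<otimes> a) \<otimes> b) + \<tau> (\<Delta> (a \<otimes> (b \<otimes> p)))"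
    using arg_cong[OF splits[of \<one> b a], of \<tau>] by (simp add: m_assoc)
  moreover have "\<tau> (\<Delta> (p \<otimes> (a \<otimes> (b \<otimes> p)))) + \<tau> (a \<otimes> \<Delta> b) = \<tau> (\<Delta> (p \<otimes> (a \<otimes> b))) + \<tau> (a \<otimes> \<Delta> (b \<otimes> p))"
    using arg_cong[OF splits[of a \<one> b], of \<tau>] by (simp add: m_assoc)
  ultimately show "\<tau> (\<Delta> (a \<otimes> b)) = \<tau> (\<Delta> a \<otimes> b \<oplus> a \<otimes> \<Delta> b)"
    by (simp add: complex_eq_iff)
qed auto

lemma derivation_\<Delta>: "derivation A \<Delta>"
  by (auto simp: derivation_def linear_maps_def \<Delta>_add \<Delta>_scale \<Delta>_mult)

end

section \<open>Continuous functions\<close>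

text \<open>Let u, v, e be the square roots of a, b, d. From d \<le> 2a comes e \<le> 2u, hence d/u
  \<le> 2e. For v > 0 the second summand is (u - v)v/u \<le> u - v, and u - v \<le> e because (u -
  v)^2 \<le> u^2 - v^2 \<le> e^2. In the application, \<open>a\<close> and \<open>b\<close> are the
  norms of two vectors and \<open>d\<close> is that of their difference.\<close>

lemma sqrt_holder_bound:
  fixes a b d :: real
  assumes "0 \<le> b" "b \<le> a" "0 < a" "0 \<le> d" "d \<le> a + b" "a - b \<le> d"
  shows "d / sqrt a + \<bar>1 / sqrt a - 1 / sqrt b\<bar> * b \<le> 3 * sqrt d"
proof -
  define u v e where "u = sqrt a" and "v = sqrt b" and "e = sqrt d"
  have sq: "a = u\<^sup>2" "b = v\<^sup>2" "d = e\<^sup>2"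
    using assms by (auto simp: u_def v_def e_def)
  have pos: "0 < u" "0 \<le> v" "v \<le> u" "0 \<le> e"
    using assms by (auto simp: u_def v_def e_def)
  have "e\<^sup>2 \<le> 4 * u\<^sup>2"
    using assms(2,5) zero_le_power2[of u] unfolding sq by linarith
  then have "e\<^sup>2 \<le> (2 * u)\<^sup>2" by (simp add: power_mult_distrib)
  then have "e \<le> 2 * u" by (rule power2_le_imp_le) (use pos in simp)
  then have 1: "d / sqrt a \<le> 2 * e"
    using pos mult_left_mono[of e "2 * u" e]
    by (simp add: sq power2_eq_square divide_le_eq mult_ac)
  have "(u - v)\<^sup>2 \<le> e\<^sup>2"
    using assms(6) mult_left_mono[OF pos(3,2)] unfolding sq by (simp add: power2_eq_square algebra_simps)
  then have "u - v \<le> e" by (rule power2_le_imp_le) (use pos in simp)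
  moreover have "\<bar>1 / sqrt a - 1 / sqrt b\<bar> * b \<le> u - v"
  proof (cases "v = 0")
    \<comment> \<open>Here \<open>b = 0\<close>, which makes the product vanish whatever the value
      of \<open>1 / sqrt b\<close>.\<close>
    case True
    then show ?thesis using pos by (simp add: sq)
  next
    case False
    then have v: "v > 0" using pos by simp
    have "\<bar>1 / u - 1 / v\<bar> = (u - v) / (u * v)"
      using pos v by (simp add: abs_if field_simps)
    then have "\<bar>1 / sqrt a - 1 / sqrt b\<bar> * b = (u - v) * (v / u)"
      using pos v by (simp add: sq power2_eq_square)
    also have "\<dots> \<le> (u - v) * 1"
      using pos by (intro mult_left_mono) auto
    finally show ?thesis by simp
  qed
  ultimately show ?thesis using 1 by (simp add: e_def)
qed

lemma abs_sqrt_diff_le: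
  fixes a b :: real
  assumes "0 \<le> a" "0 \<le> b"
  shows "\<bar>sqrt a - sqrt b\<bar> \<le> sqrt \<bar>a - b\<bar>"
proof -
  have *: "sqrt x - sqrt y \<le> sqrt (x - y)" if "0 \<le> y" "y \<le> x" for x y :: real
    using sqrt_add_le_add_sqrt[of y "x - y"] that by simp
  show ?thesis
    using *[of b a] *[of a b] assms by (cases "b \<le> a") (auto simp: abs_if)
qed

context complex_normed_space
begin

lemma norm_minus_commute: "x \<in> carrier V \<Longrightarrow> y \<in> carrier V \<Longrightarrow> N (x \<ominus> y) = N (y \<ominus> x)"
  using norm_uminus[of "x \<ominus> y"] by (simp add: a_minus_def M.minus_add M.a_comm)

lemma norm_triangle_minus: "x \<in> carrier V \<Longrightarrow> y \<in> carrier V \<Longrightarrow> N (x \<ominus> y) \<le> N x + N y"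
  using norm_triangle[of x "\<ominus> y"] by (simp add: a_minus_def norm_uminus)

lemma norm_le_minus: "x \<in> carrier V \<Longrightarrow> y \<in> carrier V \<Longrightarrow> N x \<le> N (x \<ominus> y) + N y"
  using norm_triangle[of "x \<ominus> y" y] by (simp add: a_minus_def M.a_assoc M.l_neg)

lemma abs_norm_diff_le: "x \<in> carrier V \<Longrightarrow> y \<in> carrier V \<Longrightarrow> \<bar>N x - N y\<bar> \<le> N (x \<ominus> y)"
  using norm_le_minus[of x y] norm_le_minus[of y x] norm_minus_commute[of x y] by simp

text \<open>Dividing a vector by the root of its norm, with value 0 at 0 because
  \<open>1 / sqrt 0 = 0\<close>, is thus Hoelder continuous and yields a continuous factor of a
  continuous function. By symmetry let ||y|| \<le> ||x||, and write the difference as c(x - y) + (c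
  - d)y with c and d the two scalars.\<close>

lemma scaled_root_holder:
  assumes x [simp]: "x \<in> carrier V" and y [simp]: "y \<in> carrier V"
  shows "N (complex_of_real (1 / sqrt (N x)) \<odot> x \<ominus> complex_of_real (1 / sqrt (N y)) \<odot> y)
    \<le> 3 * sqrt (N (x \<ominus> y))"
proof -
  define h where "h z = complex_of_real (1 / sqrt (N z)) \<odot> z" for z
  have main: "N (h x \<ominus> h y) \<le> 3 * sqrt (N (x \<ominus> y))"
    if le: "N y \<le> N x" and [simp]: "x \<in> carrier V" "y \<in> carrier V" for x y
  proof (cases "N x = 0")
    case True
    then have "x = \<zero>" "y = \<zero>"
      using le norm_nonneg[of y] by (auto simp flip: norm_eq_zero)
    then show ?thesis by (simp add: h_def M.minus_eq norm_uminus)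
  next
    case False
    let ?c = "complex_of_real (1 / sqrt (N x))" and ?d = "complex_of_real (1 / sqrt (N y))"
    have "h x \<ominus> h y = ?c \<odot> (x \<ominus> y) \<oplus> (?c - ?d) \<odot> y"
    proof -
      have "?c \<odot> (x \<ominus> y) \<oplus> (?c - ?d) \<odot> y = (?c \<odot> x \<oplus> ((- ?c) \<odot> y)) \<oplus> (?c \<odot> y \<oplus> (- ?d) \<odot> y)"
        using scale_add_left[of y ?c "- ?d"]
        by (simp add: a_minus_def uminus_eq_scale scale_add_right scale_scale)
      also have "\<dots> = ?c \<odot> x \<oplus> (- ?d) \<odot> y"
        by (simp add: M.a_assoc scale_minus_left M.r_neg1)
      finally show ?thesis by (simp add: h_def a_minus_def scale_minus_left)
    qed
    then have "N (h x \<ominus> h y) \<le> cmod ?c * N (x \<ominus> y) + cmod (?c - ?d) * N y"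
      using norm_triangle[of "?c \<odot> (x \<ominus> y)" "(?c - ?d) \<odot> y"] by (simp add: norm_smult)
    also have "cmod ?c = 1 / sqrt (N x)"
      using norm_nonneg[of x] by (simp add: norm_divide)
    also have "cmod (?c - ?d) = \<bar>1 / sqrt (N x) - 1 / sqrt (N y)\<bar>"
      by (simp only: norm_of_real flip: of_real_diff)
    also have "1 / sqrt (N x) * N (x \<ominus> y) + \<bar>1 / sqrt (N x) - 1 / sqrt (N y)\<bar> * N y \<le> 3 * sqrt (N (x \<ominus> y))"
      using sqrt_holder_bound[of "N y" "N x" "N (x \<ominus> y)"] False le norm_nonneg[of x]
        norm_triangle_minus[of x y] abs_norm_diff_le[of x y]
      by (simp add: norm_nonneg)
    finally show ?thesis .
  qed
  show ?thesis
    using main[of x y] main[of y x] norm_minus_commute[of x y] norm_minus_commute[of "h x" "h y"]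
    by (cases "N y \<le> N x") (simp_all add: h_def)
qed

end

context unital_normed_algebra
begin

text \<open>Stated through limits of real functions so that continuity can be proved by majorants,
  as in \<open>restrict_in_C\<close>.\<close>

lemma continuous_map_iff_tendsto:
  "continuous_map \<Omega> (norm_topology A) f \<longleftrightarrow>
    (\<forall>t\<in>topspace \<Omega>. f t \<in> carrier A \<and> ((\<lambda>s. anorm A (f s \<ominus> f t)) \<longlongrightarrow> 0) (atin \<Omega> t))"
    (is "?L \<longleftrightarrow> ?R")
proof -
  interpret metric: Metric_space "carrier A" "norm_dist A (anorm A)"
    by (rule Metric_space_norm_dist)
  have ev: "eventually (\<lambda>s. s \<in> topspace \<Omega>) (atin \<Omega> t)" for t
    by (auto simp: eventually_atin)
  have eq: "((\<lambda>s. norm_dist A (anorm A) (f s) (f t)) \<longlongrightarrow> 0) (atin \<Omega> t) \<longleftrightarrow>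
      ((\<lambda>s. anorm A (f s \<ominus> f t)) \<longlongrightarrow> 0) (atin \<Omega> t)"
    if "f \<in> topspace \<Omega> \<rightarrow> carrier A" "t \<in> topspace \<Omega>" for t
    using that by (intro tendsto_cong eventually_mono[OF ev]) (auto simp: norm_dist_def)
  have ev': "eventually (\<lambda>s. f s \<in> carrier A) (atin \<Omega> t)" if "f \<in> topspace \<Omega> \<rightarrow> carrier A" for t
    using that by (intro eventually_mono[OF ev]) auto
  show ?thesis
  proof
    assume L: ?L
    then have f: "f \<in> topspace \<Omega> \<rightarrow> carrier A"
      using continuous_map_funspace[OF L] by (simp add: norm_topology_def)
    show ?R
      using L f eq[OF f]
      by (auto simp: continuous_map_atin norm_topology_def metric.limitin_metric_dist_null)
  next
    assume R: ?R
    then have f: "f \<in> topspace \<Omega> \<rightarrow> carrier A" by auto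
    show ?L
      using R eq[OF f] ev'[OF f]
      by (auto simp: continuous_map_atin norm_topology_def metric.limitin_metric_dist_null)
  qed
qed

end

section \<open>The algebra C(\<Omega>, A) and its point evaluations\<close>

lemma continuous_functions_carrier:
  "f \<in> carrier (continuous_functions \<Omega> A) \<longleftrightarrow>
    f \<in> extensional (topspace \<Omega>) \<and> continuous_map \<Omega> (norm_topology A) f"
  by (simp add: continuous_functions_def)

lemma continuous_functions_simps [simp]:
  "f \<oplus>\<^bsub>continuous_functions \<Omega> A\<^esub> g = (\<lambda>t\<in>topspace \<Omega>. f t \<oplus>\<^bsub>A\<^esub> g t)"
  "f \<otimes>\<^bsub>continuous_functions \<Omega> A\<^esub> g = (\<lambda>t\<in>topspace \<Omega>. f t \<otimes>\<^bsub>A\<^esub> g t)"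
  "c \<odot>\<^bsub>continuous_functions \<Omega> A\<^esub> f = (\<lambda>t\<in>topspace \<Omega>. c \<odot>\<^bsub>A\<^esub> f t)"
  by (simp_all add: continuous_functions_def)

locale continuous_function_algebra = unital_normed_algebra +
  fixes \<Omega> :: "'w topology"
  assumes compact: "compact_space \<Omega>"
begin

abbreviation "C \<equiv> continuous_functions \<Omega> A"

lemma C_extensional: "f \<in> carrier C \<Longrightarrow> f \<in> extensional (topspace \<Omega>)"
  by (simp add: continuous_functions_carrier)

lemma C_value [simp]: "f \<in> carrier C \<Longrightarrow> t \<in> topspace \<Omega> \<Longrightarrow> f t \<in> carrier A"
  by (simp add: continuous_functions_carrier continuous_map_iff_tendsto)

lemma C_tendsto:
  "f \<in> carrier C \<Longrightarrow> t \<in> topspace \<Omega> \<Longrightarrow> ((\<lambda>s. anorm A (f s \<ominus> f t)) \<longlongrightarrow> 0) (atin \<Omega> t)"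
  by (simp add: continuous_functions_carrier continuous_map_iff_tendsto)

lemma C_eqI:
  "\<lbrakk>f \<in> carrier C; g \<in> carrier C; \<And>t. t \<in> topspace \<Omega> \<Longrightarrow> f t = g t\<rbrakk> \<Longrightarrow> f = g"
  by (auto intro: extensionalityI C_extensional)

text \<open>A comparison test: \<open>B t\<close> acts as a modulus of continuity at
  \<open>t\<close>, so each closure property comes down to a norm estimate and a limit.\<close>

lemma restrict_in_C:
  assumes "\<And>t. t \<in> topspace \<Omega> \<Longrightarrow> f t \<in> carrier A"
    and le: "\<And>s t. \<lbrakk>s \<in> topspace \<Omega>; t \<in> topspace \<Omega>\<rbrakk> \<Longrightarrow> anorm A (f s \<ominus> f t) \<le> B t s"
    and B: "\<And>t. t \<in> topspace \<Omega> \<Longrightarrow> (B t \<longlongrightarrow> 0) (atin \<Omega> t)"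
  shows "(\<lambda>t\<in>topspace \<Omega>. f t) \<in> carrier C"
proof -
  have "((\<lambda>s. anorm A ((if s \<in> topspace \<Omega> then f s else undefined) \<ominus> f t)) \<longlongrightarrow> 0) (atin \<Omega> t)" if t: "t \<in> topspace \<Omega>" for t
  proof (rule Lim_null_comparison[OF _ B[OF t]])
    have "eventually (\<lambda>s. s \<in> topspace \<Omega>) (atin \<Omega> t)"
      by (auto simp: eventually_atin)
    then show "eventually (\<lambda>s. norm (anorm A ((if s \<in> topspace \<Omega> then f s else undefined) \<ominus> f t)) \<le> B t s) (atin \<Omega> t)"
      by eventually_elim (use t le assms(1) norm_nonneg in auto)
  qed
  then show ?thesis
    using assms(1) by (auto simp: continuous_functions_carrier continuous_map_iff_tendsto)
qed

lemma C_const [simp]: "x \<in> carrier A \<Longrightarrow> (\<lambda>t\<in>topspace \<Omega>. x) \<in> carrier C"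
  by (rule restrict_in_C[where B = "\<lambda>t s. 0"]) (auto simp: a_minus_def r_neg)

lemma C_add [simp]:
  assumes f [simp]: "f \<in> carrier C" and g [simp]: "g \<in> carrier C"
  shows "(\<lambda>t\<in>topspace \<Omega>. f t \<oplus> g t) \<in> carrier C"
proof (rule restrict_in_C)
  fix s t assume [simp]: "s \<in> topspace \<Omega>" "t \<in> topspace \<Omega>"
  have "f s \<oplus> g s \<ominus> (f t \<oplus> g t) = (f s \<ominus> f t) \<oplus> (g s \<ominus> g t)"
    by (simp add: a_minus_def minus_add a_ac)
  then show "anorm A (f s \<oplus> g s \<ominus> (f t \<oplus> g t)) \<le> anorm A (f s \<ominus> f t) + anorm A (g s \<ominus> g t)"
    by (simp add: norm_triangle)
next
  fix t assume t: "t \<in> topspace \<Omega>"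
  show "((\<lambda>s. anorm A (f s \<ominus> f t) + anorm A (g s \<ominus> g t)) \<longlongrightarrow> 0) (atin \<Omega> t)"
    using tendsto_add[OF C_tendsto[OF f t] C_tendsto[OF g t]] by simp
qed simp

lemma C_scale [simp]:
  assumes f [simp]: "f \<in> carrier C"
  shows "(\<lambda>t\<in>topspace \<Omega>. c \<odot> f t) \<in> carrier C"
proof (rule restrict_in_C)
  fix s t assume [simp]: "s \<in> topspace \<Omega>" "t \<in> topspace \<Omega>"
  have "c \<odot> f s \<ominus> c \<odot> f t = c \<odot> (f s \<ominus> f t)"
    by (simp add: a_minus_def uminus_eq_scale scale_add_right scale_scale mult.commute)
  then show "anorm A (c \<odot> f s \<ominus> c \<odot> f t) \<le> cmod c * anorm A (f s \<ominus> f t)"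
    by (simp add: norm_smult)
next
  fix t assume t: "t \<in> topspace \<Omega>"
  show "((\<lambda>s. cmod c * anorm A (f s \<ominus> f t)) \<longlongrightarrow> 0) (atin \<Omega> t)"
    using tendsto_mult_left[OF C_tendsto[OF f t], of "cmod c"] by simp
qed simp

lemma C_mult [simp]:
  assumes f [simp]: "f \<in> carrier C" and g [simp]: "g \<in> carrier C"
  shows "(\<lambda>t\<in>topspace \<Omega>. f t \<otimes> g t) \<in> carrier C"
proof (rule restrict_in_C)
  fix s t assume [simp]: "s \<in> topspace \<Omega>" "t \<in> topspace \<Omega>"
  have "f s \<otimes> g s \<ominus> f t \<otimes> g t = (f s \<ominus> f t) \<otimes> g s \<oplus> f t \<otimes> (g s \<ominus> g t)"
    by (simp add: a_minus_def l_distr r_distr l_minus r_minus a_ac r_neg1 r_neg2)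
  then have "anorm A (f s \<otimes> g s \<ominus> f t \<otimes> g t)
      \<le> anorm A ((f s \<ominus> f t) \<otimes> g s) + anorm A (f t \<otimes> (g s \<ominus> g t))"
    by (simp add: norm_triangle)
  also have "\<dots> \<le> anorm A (f s \<ominus> f t) * anorm A (g s) + anorm A (f t) * anorm A (g s \<ominus> g t)"
    by (intro add_mono anorm_mult) auto
  \<comment> \<open>\<open>anorm A (g s)\<close> is estimated so that \<open>s\<close> occurs only
    in quantities with a known limit at \<open>t\<close>.\<close>
  also have "\<dots> \<le> anorm A (f s \<ominus> f t) * (anorm A (g s \<ominus> g t) + anorm A (g t))
      + anorm A (f t) * anorm A (g s \<ominus> g t)"
    by (intro add_mono mult_left_mono norm_le_minus norm_nonneg order_refl) auto
  finally show "anorm A (f s \<otimes> g s \<ominus> f t \<otimes> g t) \<le> \<dots>" .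
next
  fix t assume t: "t \<in> topspace \<Omega>"
  show "((\<lambda>s. anorm A (f s \<ominus> f t) * (anorm A (g s \<ominus> g t) + anorm A (g t))
      + anorm A (f t) * anorm A (g s \<ominus> g t)) \<longlongrightarrow> 0) (atin \<Omega> t)"
    by (rule tendsto_eq_intros C_tendsto[OF f t] C_tendsto[OF g t] refl | simp)+
qed simp

text \<open>The norm function is continuous, so compactness of \<open>\<Omega>\<close> bounds its
  image. Hence the \<open>Sup\<close> in the norm of \<open>C\<close> dominates every value.\<close>

lemma C_norm_bounded:
  assumes f [simp]: "f \<in> carrier C"
  shows "bdd_above ((\<lambda>t. anorm A (f t)) ` topspace \<Omega>)"
proof -
  have "continuous_map \<Omega> euclideanreal (\<lambda>t. anorm A (f t))"
    unfolding continuous_map_atin limitin_canonical_iff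
  proof
    fix t assume t [simp]: "t \<in> topspace \<Omega>"
    have "((\<lambda>s. anorm A (f s) - anorm A (f t)) \<longlongrightarrow> 0) (atin \<Omega> t)"
    proof (rule Lim_null_comparison[OF _ C_tendsto[OF f t]])
      have "eventually (\<lambda>s. s \<in> topspace \<Omega>) (atin \<Omega> t)"
        by (auto simp: eventually_atin)
      then show "eventually (\<lambda>s. norm (anorm A (f s) - anorm A (f t)) \<le> anorm A (f s \<ominus> f t)) (atin \<Omega> t)"
        by eventually_elim (simp add: abs_norm_diff_le)
    qed
    then show "((\<lambda>s. anorm A (f s)) \<longlongrightarrow> anorm A (f t)) (atin \<Omega> t)"
      by (rule Lim_null[THEN iffD2])
  qed
  then have "compactin euclideanreal ((\<lambda>t. anorm A (f t)) ` topspace \<Omega>)"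
    using compact image_compactin unfolding compact_space_def by blast
  then show ?thesis
    by (simp add: bounded_imp_bdd_above compact_imp_bounded)
qed

text \<open>The sup norm dominates the norm at \<open>t\<close>. These functionals let
  \<open>\<Delta>\<close> be tested one fibre at a time.\<close>

lemma evaluation_dual:
  assumes \<phi>: "\<phi> \<in> dual_space A" and t: "t \<in> topspace \<Omega>"
  shows "(\<lambda>f. \<phi> (f t)) \<in> dual_space C"
proof -
  obtain K where K: "K \<ge> 0" "\<And>x. x \<in> carrier A \<Longrightarrow> cmod (\<phi> x) \<le> K * anorm A x"
    using dual_space_bounded[OF \<phi>] norm_nonneg by metis
  show ?thesis
  proof (rule dual_spaceI)
    fix f assume f: "f \<in> carrier C"
    have "anorm A (f t) \<le> Sup (insert 0 ((\<lambda>t. anorm A (f t)) ` topspace \<Omega>))"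
      using C_norm_bounded[OF f] t by (intro cSup_upper) auto
    then have "K * anorm A (f t) \<le> K * anorm C f"
      using K(1) by (intro mult_left_mono) (simp_all add: continuous_functions_def)
    then show "cmod (\<phi> (f t)) \<le> K * anorm C f"
      using K(2)[of "f t"] f t by simp
  qed (use t in \<open>simp_all add: dual_simps[OF \<phi>]\<close>)
qed

text \<open>
  A function vanishing at \<open>t\<close> is a product of two such functions, \<open>a = (\<surd>\<parallel>a\<parallel> 1) (a / \<surd>\<parallel>a\<parallel>)\<close>,
  with \<open>a / \<surd>\<parallel>a\<parallel>\<close> read as \<open>0\<close> where \<open>a\<close> vanishes.
\<close>

lemma derivation_vanishes:
  assumes D: "derivation C D" and a [simp]: "a \<in> carrier C" and t: "t \<in> topspace \<Omega>" and "a t = \<zero>"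
  shows "D a t = \<zero>"
proof -
  define f g where "f = (\<lambda>s\<in>topspace \<Omega>. complex_of_real (sqrt (anorm A (a s))) \<odot> \<one>)"
    and "g = (\<lambda>s\<in>topspace \<Omega>. complex_of_real (1 / sqrt (anorm A (a s))) \<odot> a s)"
  have lim: "((\<lambda>s. c * sqrt (anorm A (a s \<ominus> a t))) \<longlongrightarrow> 0) (atin \<Omega> t)" if "t \<in> topspace \<Omega>" for c t
    by (rule tendsto_eq_intros C_tendsto[OF a that] refl | simp)+
  have f: "f \<in> carrier C"
    unfolding f_def
  proof (rule restrict_in_C)
    fix s t assume [simp]: "s \<in> topspace \<Omega>" "t \<in> topspace \<Omega>"
    let ?x = "sqrt (anorm A (a s))" and ?y = "sqrt (anorm A (a t))"
    have "complex_of_real ?x \<odot> \<one> \<ominus> complex_of_real ?y \<odot> \<one> = complex_of_real (?x - ?y) \<odot> \<one>"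
      using scale_add_left[of \<one> "complex_of_real ?x" "- complex_of_real ?y"]
      by (simp add: a_minus_def scale_minus_left)
    then have "anorm A (complex_of_real ?x \<odot> \<one> \<ominus> complex_of_real ?y \<odot> \<one>) = anorm A \<one> * \<bar>?x - ?y\<bar>"
      by (simp add: norm_smult del: of_real_diff)
    also have "\<bar>?x - ?y\<bar> \<le> sqrt \<bar>anorm A (a s) - anorm A (a t)\<bar>"
      by (simp add: abs_sqrt_diff_le norm_nonneg)
    then have "anorm A \<one> * \<bar>?x - ?y\<bar> \<le> anorm A \<one> * sqrt (anorm A (a s \<ominus> a t))"
      using abs_norm_diff_le[of "a s" "a t"]
      by (intro mult_left_mono norm_nonneg) (auto intro: order.trans)
    finally show "anorm A (complex_of_real ?x \<odot> \<one> \<ominus> complex_of_real ?y \<odot> \<one>)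
        \<le> anorm A \<one> * sqrt (anorm A (a s \<ominus> a t))" .
  qed (auto intro: lim)
  have g: "g \<in> carrier C"
    unfolding g_def by (rule restrict_in_C[OF _ scaled_root_holder lim]) auto
  have "a = f \<otimes>\<^bsub>C\<^esub> g"
  proof (rule C_eqI)
    fix s assume [simp]: "s \<in> topspace \<Omega>"
    have "complex_of_real (sqrt (anorm A (a s))) * complex_of_real (1 / sqrt (anorm A (a s))) = 1"
      if "a s \<noteq> \<zero>"
      using that norm_eq_zero[of "a s"] by (simp flip: of_real_mult)
    then show "a s = (f \<otimes>\<^bsub>C\<^esub> g) s"
      by (cases "a s = \<zero>") (simp_all add: f_def g_def smult_mult_left scale_scale del: of_real_divide)
  qed (use f g in auto)
  then have "D a t = D f t \<otimes> g t \<oplus> f t \<otimes> D g t"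
    using derivation_mult[OF D f g] t by simp
  moreover have "f t = \<zero>" "g t = \<zero>"
    using t \<open>a t = \<zero>\<close> by (simp_all add: f_def g_def)
  ultimately show ?thesis
    using derivation_closed[OF D f] derivation_closed[OF D g] t by simp
qed

text \<open>The difference of \<open>a\<close> and the constant function with value
  \<open>a t\<close> vanishes at \<open>t\<close>, so \<open>derivation_vanishes\<close> applies to
  it.\<close>

lemma derivation_fibre:
  assumes D: "derivation C D" and a [simp]: "a \<in> carrier C" and t [simp]: "t \<in> topspace \<Omega>"
  shows "D a t = D (\<lambda>s\<in>topspace \<Omega>. a t) t"
proof -
  let ?c = "\<lambda>s\<in>topspace \<Omega>. a t"
  let ?m = "(-1) \<odot>\<^bsub>C\<^esub> ?c"
  note [simp] = derivation_closed[OF D]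
  have c: "?c \<in> carrier C" and m: "?m \<in> carrier C"
    using C_const[of "a t"] C_scale[of ?c "-1"] by auto
  have "D (a \<oplus>\<^bsub>C\<^esub> ?m) t = \<zero>"
    using C_add[OF a m] by (intro derivation_vanishes[OF D]) (auto simp: r_neg simp flip: uminus_eq_scale)
  moreover have "D (a \<oplus>\<^bsub>C\<^esub> ?m) = D a \<oplus>\<^bsub>C\<^esub> (-1) \<odot>\<^bsub>C\<^esub> D ?c"
    unfolding derivation_add[OF D a m] derivation_scale[OF D c] ..
  ultimately have "D a t \<ominus> D ?c t = \<zero>"
    using c by (simp add: a_minus_def uminus_eq_scale)
  then show ?thesis
    using c by (simp add: minus_eq_zero_iff)
qed

text \<open>Constant functions embed \<open>A\<close> into \<open>C\<close> compatibly with the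
  operations, and evaluation at \<open>t\<close> brings the values of \<open>D\<close> back to
  \<open>A\<close>.\<close>

lemma derivation_at_point:
  assumes D: "derivation C D" and t [simp]: "t \<in> topspace \<Omega>"
  shows "derivation A (\<lambda>x. D (\<lambda>s\<in>topspace \<Omega>. x) t)"
proof -
  let ?c = "\<lambda>x. \<lambda>s\<in>topspace \<Omega>. x"
  note [simp] = derivation_closed[OF D]
  have "D (?c (x \<oplus> y)) t = D (?c x) t \<oplus> D (?c y) t" "D (?c (x \<otimes> y)) t = D (?c x) t \<otimes> y \<oplus> x \<otimes> D (?c y) t"
    if "x \<in> carrier A" "y \<in> carrier A" for x y
  proof -
    have "?c (x \<oplus> y) = ?c x \<oplus>\<^bsub>C\<^esub> ?c y" "?c (x \<otimes> y) = ?c x \<otimes>\<^bsub>C\<^esub> ?c y" by auto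
    then show "D (?c (x \<oplus> y)) t = D (?c x) t \<oplus> D (?c y) t" "D (?c (x \<otimes> y)) t = D (?c x) t \<otimes> y \<oplus> x \<otimes> D (?c y) t"
      using that derivation_add[OF D, of "?c x" "?c y"] derivation_mult[OF D, of "?c x" "?c y"] by auto
  qed
  moreover have "D (?c (c \<odot> x)) t = c \<odot> D (?c x) t" if "x \<in> carrier A" for c x
  proof -
    have "?c (c \<odot> x) = c \<odot>\<^bsub>C\<^esub> ?c x" by auto
    then show ?thesis using that derivation_scale[OF D, of "?c x"] by simp
  qed
  ultimately show ?thesis
    by (auto simp: derivation_def linear_maps_def)
qed

end

section \<open>Reduction of weak-2-local derivations of C(\<Omega>, A) to the fibres\<close>

locale continuous_functions_atomic = atomic_algebra + continuous_function_algebra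
begin

theorem w2ld_imp_derivation:
  assumes \<Delta>: "weak_2_local_derivation C \<Delta>"
  shows "derivation C \<Delta>"
proof -
  define F where "F t x = \<Delta> (\<lambda>s\<in>topspace \<Omega>. x) t" for t x
  note [simp] = w2ld_closed[OF \<Delta>]
  have F: "derivation A (F t)" if t [simp]: "t \<in> topspace \<Omega>" for t
  proof -
    have "weak_2_local_derivation A (F t)"
      unfolding weak_2_local_derivation_def
    proof (intro conjI ballI)
      show "F t \<in> carrier A \<rightarrow> carrier A" by (auto simp: F_def)
      fix x y \<phi> assume xy: "x \<in> carrier A" "y \<in> carrier A" and \<phi>: "\<phi> \<in> dual_space A"
      \<comment> \<open>The hypothesis is used for two constant functions and for \<phi> composed
        with evaluation at \<open>t\<close>; \<open>derivation_at_point\<close> turns the resulting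
        \<open>D\<close> into a derivation of \<open>A\<close>.\<close>
      obtain D where "derivation C D" "\<phi> (F t x) = \<phi> (D (\<lambda>s\<in>topspace \<Omega>. x) t)"
          "\<phi> (F t y) = \<phi> (D (\<lambda>s\<in>topspace \<Omega>. y) t)"
        using \<Delta>[unfolded weak_2_local_derivation_def, THEN conjunct2, rule_format,
            OF C_const[OF xy(1)] C_const[OF xy(2)] evaluation_dual[OF \<phi> t]]
        unfolding F_def by auto
      then show "\<exists>D. derivation A D \<and> \<phi> (F t x) = \<phi> (D x) \<and> \<phi> (F t y) = \<phi> (D y)"
        using derivation_at_point[OF _ t] by blast
    qed
    then interpret atomic_w2ld A "F t" by unfold_locales
    show ?thesis by (rule derivation_\<Delta>)
  qed
  \<comment> \<open>Every derivation takes the same value at \<open>t\<close> on \<open>a\<close>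
    and on the constant function with value \<open>a t\<close>, and this transfers to
    \<open>\<Delta>\<close>. All identities for \<open>\<Delta>\<close> then follow pointwise from
    those for \<open>F t\<close>.\<close>
  have eq: "\<Delta> a t = F t (a t)" if [simp]: "a \<in> carrier C" and t [simp]: "t \<in> topspace \<Omega>" for a t
  proof (rule dual_separates)
    fix \<phi> assume \<phi>: "\<phi> \<in> dual_space A"
    show "\<phi> (\<Delta> a t) = \<phi> (F t (a t))"
      unfolding F_def
    proof (rule w2ld_transfer[OF \<Delta> evaluation_dual[OF \<phi> t] that(1) C_const])
      show "\<phi> (D a t) = \<phi> (D (\<lambda>s\<in>topspace \<Omega>. a t) t)" if "derivation C D" for D
        by (rule arg_cong[OF derivation_fibre[OF that \<open>a \<in> carrier C\<close> t]])
    qed simp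
  qed (auto simp: F_def)
  have "\<Delta> (a \<oplus>\<^bsub>C\<^esub> b) = \<Delta> a \<oplus>\<^bsub>C\<^esub> \<Delta> b"
      if a [simp]: "a \<in> carrier C" and b [simp]: "b \<in> carrier C" for a b
  proof (rule C_eqI)
    show "\<Delta> (a \<oplus>\<^bsub>C\<^esub> b) t = (\<Delta> a \<oplus>\<^bsub>C\<^esub> \<Delta> b) t" if [simp]: "t \<in> topspace \<Omega>" for t
      using C_add[OF a b] by (simp add: eq derivation_add[OF F])
  qed (use C_add[OF a b] C_add[of "\<Delta> a" "\<Delta> b"] in simp_all)
  moreover have "\<Delta> (a \<otimes>\<^bsub>C\<^esub> b) = (\<Delta> a \<otimes>\<^bsub>C\<^esub> b) \<oplus>\<^bsub>C\<^esub> (a \<otimes>\<^bsub>C\<^esub> \<Delta> b)"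
      if a [simp]: "a \<in> carrier C" and b [simp]: "b \<in> carrier C" for a b
  proof (rule C_eqI)
    show "\<Delta> (a \<otimes>\<^bsub>C\<^esub> b) t = ((\<Delta> a \<otimes>\<^bsub>C\<^esub> b) \<oplus>\<^bsub>C\<^esub> (a \<otimes>\<^bsub>C\<^esub> \<Delta> b)) t"
      if [simp]: "t \<in> topspace \<Omega>" for t
      using C_mult[OF a b] by (simp add: eq derivation_mult[OF F])
    show "(\<Delta> a \<otimes>\<^bsub>C\<^esub> b) \<oplus>\<^bsub>C\<^esub> (a \<otimes>\<^bsub>C\<^esub> \<Delta> b) \<in> carrier C"
      using C_add[OF C_mult[of "\<Delta> a" b] C_mult[of a "\<Delta> b"]] by simp
  qed (use C_mult[OF a b] in simp)
  moreover have "\<Delta> (c \<odot>\<^bsub>C\<^esub> a) = c \<odot>\<^bsub>C\<^esub> \<Delta> a" if a [simp]: "a \<in> carrier C" for c a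
  proof (rule C_eqI)
    show "\<Delta> (c \<odot>\<^bsub>C\<^esub> a) t = (c \<odot>\<^bsub>C\<^esub> \<Delta> a) t" if [simp]: "t \<in> topspace \<Omega>" for t
      using C_scale[OF a] by (simp add: eq derivation_scale[OF F])
  qed (use C_scale[OF a] C_scale[of "\<Delta> a"] in simp_all)
  ultimately show ?thesis
    using w2ld_closed[OF \<Delta>] unfolding derivation_def linear_maps_def by blast
qed

end

section \<open>Bounded operators\<close>

lemma operator_algebra_simps [simp]:
  "carrier (operator_algebra H) = bounded_operators H"
  "S \<otimes>\<^bsub>operator_algebra H\<^esub> T = (\<lambda>x\<in>carrier H. S (T x))"
  "\<one>\<^bsub>operator_algebra H\<^esub> = (\<lambda>x\<in>carrier H. x)"
  "\<zero>\<^bsub>operator_algebra H\<^esub> = (\<lambda>x\<in>carrier H. \<zero>\<^bsub>H\<^esub>)"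
  "S \<oplus>\<^bsub>operator_algebra H\<^esub> T = (\<lambda>x\<in>carrier H. S x \<oplus>\<^bsub>H\<^esub> T x)"
  "c \<odot>\<^bsub>operator_algebra H\<^esub> T = (\<lambda>x\<in>carrier H. c \<odot>\<^bsub>H\<^esub> T x)"
  by (simp_all add: operator_algebra_def)

context complex_inner_product_space
begin

abbreviation "BH \<equiv> operator_algebra H"

lemma operator_closed [simp]: "T \<in> bounded_operators H \<Longrightarrow> x \<in> carrier H \<Longrightarrow> T x \<in> carrier H"
  and operator_add:
    "T \<in> bounded_operators H \<Longrightarrow> x \<in> carrier H \<Longrightarrow> y \<in> carrier H \<Longrightarrow> T (x \<oplus> y) = T x \<oplus> T y"
  and operator_scale: "T \<in> bounded_operators H \<Longrightarrow> x \<in> carrier H \<Longrightarrow> T (c \<odot> x) = c \<odot> T x"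
  and operator_extensional: "T \<in> bounded_operators H \<Longrightarrow> T \<in> extensional (carrier H)"
  by (auto simp: bounded_operators_def linear_maps_def)

lemma operator_zero [simp]: "T \<in> bounded_operators H \<Longrightarrow> T \<zero> = \<zero>"
  using operator_scale[of T \<zero> 0] by simp

lemma operator_eqI:
  "\<lbrakk>S \<in> bounded_operators H; T \<in> bounded_operators H; \<And>x. x \<in> carrier H \<Longrightarrow> S x = T x\<rbrakk> \<Longrightarrow> S = T"
  by (rule extensionalityI[of _ "carrier H"]) (simp_all add: operator_extensional)

lemma bounded_operatorI:
  assumes "\<And>x. x \<in> carrier H \<Longrightarrow> f x \<in> carrier H"
    and "\<And>x y. x \<in> carrier H \<Longrightarrow> y \<in> carrier H \<Longrightarrow> f (x \<oplus> y) = f x \<oplus> f y"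
    and "\<And>c x. x \<in> carrier H \<Longrightarrow> f (c \<odot> x) = c \<odot> f x"
    and "\<And>x. x \<in> carrier H \<Longrightarrow> hnorm H (f x) \<le> K * hnorm H x"
  shows "(\<lambda>x\<in>carrier H. f x) \<in> bounded_operators H"
proof -
  have "(\<lambda>x\<in>carrier H. f x) \<in> linear_maps H H"
    using assms(1) by (simp add: linear_maps_def assms(2,3))
  moreover have "\<forall>x\<in>carrier H. hnorm H ((\<lambda>x\<in>carrier H. f x) x) \<le> K * hnorm H x"
    by (simp add: assms(4))
  ultimately show ?thesis
    unfolding bounded_operators_def by blast
qed

section \<open>The operator norm and the algebra structure of B(H)\<close>

lemma anorm_upper:
  assumes T: "T \<in> bounded_operators H" and "x \<in> carrier H" "hnorm H x \<le> 1"
  shows "hnorm H (T x) \<le> anorm BH T"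
proof -
  obtain K where K: "\<And>x. x \<in> carrier H \<Longrightarrow> hnorm H (T x) \<le> K * hnorm H x"
    using T unfolding bounded_operators_def by blast
  \<comment> \<open>The constant of a bounded operator comes without a sign, hence the absolute
    value.\<close>
  have "hnorm H (T x) \<le> \<bar>K\<bar>" if "x \<in> carrier H" "hnorm H x \<le> 1" for x
  proof -
    have "K * hnorm H x \<le> \<bar>K\<bar> * hnorm H x"
      by (intro mult_right_mono norm_nonneg that) auto
    also have "\<dots> \<le> \<bar>K\<bar> * 1"
      by (intro mult_left_mono that) auto
    finally show ?thesis using K[OF that(1)] by simp
  qed
  then have "bdd_above ((\<lambda>x. hnorm H (T x)) ` {x \<in> carrier H. hnorm H x \<le> 1})"
    by (intro bdd_aboveI2[where M = "\<bar>K\<bar>"]) blast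
  then show ?thesis
    using cSUP_upper[of x "{x \<in> carrier H. hnorm H x \<le> 1}" "\<lambda>x. hnorm H (T x)"] assms
    by (simp add: operator_algebra_def)
qed

lemma anorm_operator_nonneg: "T \<in> bounded_operators H \<Longrightarrow> 0 \<le> anorm BH T"
  using anorm_upper[of T \<zero>] by simp

lemma anorm_bound:
  assumes T: "T \<in> bounded_operators H" and x: "x \<in> carrier H"
  shows "hnorm H (T x) \<le> anorm BH T * hnorm H x"
proof (cases "x = \<zero>")
  case True
  then show ?thesis using T by simp
next
  case False
  then have pos: "hnorm H x > 0"
    using norm_eq_zero[OF x] norm_nonneg[OF x] by (simp add: order_less_le)
  have "hnorm H (T (complex_of_real (1 / hnorm H x) \<odot> x)) \<le> anorm BH T"
    using pos x by (intro anorm_upper[OF T]) (simp_all add: norm_smult norm_divide)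
  then show ?thesis
    using pos x T by (simp add: operator_scale norm_smult norm_divide field_simps)
qed

lemma anorm_least:
  assumes "0 \<le> K" and "\<And>x. x \<in> carrier H \<Longrightarrow> hnorm H (T x) \<le> K * hnorm H x"
  shows "anorm BH T \<le> K"
proof -
  have "(SUP x\<in>{x \<in> carrier H. hnorm H x \<le> 1}. hnorm H (T x)) \<le> K"
  proof (rule cSUP_least)
    show "{x \<in> carrier H. hnorm H x \<le> 1} \<noteq> {}"
      by (auto intro!: exI[of _ \<zero>])
    fix x assume "x \<in> {x \<in> carrier H. hnorm H x \<le> 1}"
    then show "hnorm H (T x) \<le> K"
      using assms(2)[of x] mult_left_mono[of "hnorm H x" 1 K] assms(1) by simp
  qed
  then show ?thesis by (simp add: operator_algebra_def)
qed

lemma operator_ops_closed [simp]: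
  "(\<lambda>x\<in>carrier H. x) \<in> bounded_operators H"
  "(\<lambda>x\<in>carrier H. \<zero>) \<in> bounded_operators H"
  "S \<in> bounded_operators H \<Longrightarrow> T \<in> bounded_operators H \<Longrightarrow> (\<lambda>x\<in>carrier H. S (T x)) \<in> bounded_operators H"
  "S \<in> bounded_operators H \<Longrightarrow> T \<in> bounded_operators H \<Longrightarrow> (\<lambda>x\<in>carrier H. S x \<oplus> T x) \<in> bounded_operators H"
  "T \<in> bounded_operators H \<Longrightarrow> (\<lambda>x\<in>carrier H. c \<odot> T x) \<in> bounded_operators H"
proof -
  show "(\<lambda>x\<in>carrier H. x) \<in> bounded_operators H"
    by (rule bounded_operatorI[where K = 1]) auto
  show "(\<lambda>x\<in>carrier H. \<zero>) \<in> bounded_operators H"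
    by (rule bounded_operatorI[where K = 0]) auto
  assume T: "T \<in> bounded_operators H"
  have "hnorm H (c \<odot> T x) \<le> (cmod c * anorm BH T) * hnorm H x" if "x \<in> carrier H" for x
    using T that anorm_bound[OF T that] by (simp add: norm_smult mult.assoc mult_left_mono)
  then show "(\<lambda>x\<in>carrier H. c \<odot> T x) \<in> bounded_operators H"
    using T by (intro bounded_operatorI[where K = "cmod c * anorm BH T"])
      (simp_all add: operator_add operator_scale scale_add_right scale_scale mult.commute)
  assume S: "S \<in> bounded_operators H"
  have "hnorm H (S (T x)) \<le> (anorm BH S * anorm BH T) * hnorm H x" if "x \<in> carrier H" for x
    using anorm_bound[OF S, of "T x"] mult_left_mono[OF anorm_bound[OF T that] anorm_operator_nonneg[OF S]]
      T that by (simp add: mult.assoc)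
  then show "(\<lambda>x\<in>carrier H. S (T x)) \<in> bounded_operators H"
    using S T by (intro bounded_operatorI[where K = "anorm BH S * anorm BH T"])
      (simp_all add: operator_add operator_scale)
  have "hnorm H (S x \<oplus> T x) \<le> (anorm BH S + anorm BH T) * hnorm H x" if "x \<in> carrier H" for x
    using norm_triangle[of "S x" "T x"] anorm_bound[OF S that] anorm_bound[OF T that] S T that
    by (simp add: distrib_right)
  then show "(\<lambda>x\<in>carrier H. S x \<oplus> T x) \<in> bounded_operators H"
    using S T by (intro bounded_operatorI[where K = "anorm BH S + anorm BH T"])
      (simp_all add: operator_add operator_scale scale_add_right M.a_ac)
qed

lemma BH_closed:
  "\<one>\<^bsub>BH\<^esub> \<in> bounded_operators H"
  "\<zero>\<^bsub>BH\<^esub> \<in> bounded_operators H"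
  "S \<in> bounded_operators H \<Longrightarrow> T \<in> bounded_operators H \<Longrightarrow> S \<otimes>\<^bsub>BH\<^esub> T \<in> bounded_operators H"
  "S \<in> bounded_operators H \<Longrightarrow> T \<in> bounded_operators H \<Longrightarrow> S \<oplus>\<^bsub>BH\<^esub> T \<in> bounded_operators H"
  "T \<in> bounded_operators H \<Longrightarrow> c \<odot>\<^bsub>BH\<^esub> T \<in> bounded_operators H"
  by simp_all

lemma anorm_one_le: "anorm BH \<one>\<^bsub>BH\<^esub> \<le> 1"
  by (rule anorm_least) auto

lemma operator_module: "module complex_field BH"
proof (intro module.intro module_axioms.intro)
  show "cring complex_field" by (rule R.is_cring)
  show "abelian_group BH"
  proof (rule abelian_groupI)
    fix T assume T: "T \<in> carrier BH"
    show "\<exists>S\<in>carrier BH. S \<oplus>\<^bsub>BH\<^esub> T = \<zero>\<^bsub>BH\<^esub>"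
    proof
      show "((-1) \<odot>\<^bsub>BH\<^esub> T) \<oplus>\<^bsub>BH\<^esub> T = \<zero>\<^bsub>BH\<^esub>"
        using T by (intro operator_eqI BH_closed) (simp_all add: M.l_neg flip: uminus_eq_scale)
    qed (use T in simp)
  qed ((intro operator_eqI BH_closed)?; simp add: M.a_ac)+
qed ((intro operator_eqI BH_closed)?;
    simp add: complex_field_def scale_add_left scale_add_right scale_scale)+

lemma operator_ring: "ring BH"
proof (rule ringI)
  show "abelian_group BH" by (rule module.axioms(2)[OF operator_module])
  show "Group.monoid BH"
    by (rule monoidI; (intro operator_eqI BH_closed)?; simp)
qed ((intro operator_eqI BH_closed)?; simp add: operator_add)+

lemma unital_normed_algebra_operators: "unital_normed_algebra BH"
proof -
  interpret A: module complex_field BH by (rule operator_module)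
  have eq_zero: "anorm BH T = 0 \<longleftrightarrow> T = \<zero>\<^bsub>BH\<^esub>" if T: "T \<in> carrier BH" for T
  proof
    assume 0: "anorm BH T = 0"
    have "T x = \<zero>" if "x \<in> carrier H" for x
      using anorm_bound[of T x] T that 0 norm_nonneg[of "T x"] norm_eq_zero[of "T x"] by simp
    then show "T = \<zero>\<^bsub>BH\<^esub>" using T by (intro operator_eqI) auto
  next
    assume "T = \<zero>\<^bsub>BH\<^esub>"
    then have "anorm BH T \<le> 0" by (intro anorm_least) auto
    then show "anorm BH T = 0" using anorm_operator_nonneg T by (simp add: order_antisym)
  qed
  have le: "anorm BH (c \<odot>\<^bsub>BH\<^esub> T) \<le> cmod c * anorm BH T" if T: "T \<in> carrier BH" for c T
    using T mult_left_mono[OF anorm_bound[of T], of _ "cmod c"]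
    by (intro anorm_least) (simp_all add: norm_smult anorm_operator_nonneg mult.assoc)
  have scale: "anorm BH (c \<odot>\<^bsub>BH\<^esub> T) = cmod c * anorm BH T" if T: "T \<in> carrier BH" for c T
  proof (cases "c = 0")
    case True
    have "anorm BH (c \<odot>\<^bsub>BH\<^esub> T) = 0"
      using T True eq_zero[of "c \<odot>\<^bsub>BH\<^esub> T"] by (auto intro!: operator_eqI)
    then show ?thesis using True by simp
  next
    case False
    \<comment> \<open>The inequality for the scalar 1/c and the operator cT supplies the reverse
      estimate.\<close>
    have "T = (1 / c) \<odot>\<^bsub>BH\<^esub> (c \<odot>\<^bsub>BH\<^esub> T)"
      using T False by (intro operator_eqI BH_closed) (simp_all add: scale_scale)
    then have "anorm BH T \<le> cmod (1 / c) * anorm BH (c \<odot>\<^bsub>BH\<^esub> T)"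
      using le[of "c \<odot>\<^bsub>BH\<^esub> T" "1 / c"] T by simp
    then have "cmod c * anorm BH T \<le> anorm BH (c \<odot>\<^bsub>BH\<^esub> T)"
      using False by (simp add: norm_divide field_simps)
    then show ?thesis using le[OF T, of c] by simp
  qed
  have add: "anorm BH (S \<oplus>\<^bsub>BH\<^esub> T) \<le> anorm BH S + anorm BH T"
    if S: "S \<in> carrier BH" and T: "T \<in> carrier BH" for S T
  proof (rule anorm_least)
    fix x assume x: "x \<in> carrier H"
    show "hnorm H ((S \<oplus>\<^bsub>BH\<^esub> T) x) \<le> (anorm BH S + anorm BH T) * hnorm H x"
      using norm_triangle[of "S x" "T x"] anorm_bound[of S x] anorm_bound[of T x] S T x
      by (simp add: distrib_right)
  qed (use S T anorm_operator_nonneg in auto)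
  have mult: "anorm BH (S \<otimes>\<^bsub>BH\<^esub> T) \<le> anorm BH S * anorm BH T"
    if S: "S \<in> carrier BH" and T: "T \<in> carrier BH" for S T
  proof (rule anorm_least)
    fix x assume x: "x \<in> carrier H"
    show "hnorm H ((S \<otimes>\<^bsub>BH\<^esub> T) x) \<le> anorm BH S * anorm BH T * hnorm H x"
      using anorm_bound[of S "T x"] mult_left_mono[OF anorm_bound[of T x] anorm_operator_nonneg[of S]] S T x
      by (simp add: mult.assoc)
  qed (use S T anorm_operator_nonneg in auto)
  show ?thesis
  proof (intro unital_normed_algebra.intro complex_normed_space.intro
      complex_normed_space_axioms.intro unital_normed_algebra_axioms.intro)
    show "module complex_field BH" by (rule operator_module)
    show "ring BH" by (rule operator_ring)
    fix S T c assume S: "S \<in> carrier BH" and T: "T \<in> carrier BH"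
    show "(c \<odot>\<^bsub>BH\<^esub> S) \<otimes>\<^bsub>BH\<^esub> T = c \<odot>\<^bsub>BH\<^esub> (S \<otimes>\<^bsub>BH\<^esub> T)"
      "S \<otimes>\<^bsub>BH\<^esub> (c \<odot>\<^bsub>BH\<^esub> T) = c \<odot>\<^bsub>BH\<^esub> (S \<otimes>\<^bsub>BH\<^esub> T)"
      using S T by (intro operator_eqI BH_closed; simp add: operator_scale)+
  qed (use eq_zero scale add mult anorm_operator_nonneg in auto)
qed

section \<open>Rank-one projections and the separation of operators\<close>

definition "line_projection \<xi> = (\<lambda>x\<in>carrier H. cinner H x \<xi> \<odot> \<xi>)"

text \<open>Compressing T by the projection P onto the line of a unit vector \<xi> gives
  \<open>cinner H (T \<xi>) \<xi>\<close> times P. Boundedness of P is the Cauchy-Schwarz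
  inequality.\<close>

lemma line_projection_minimal:
  assumes [simp]: "\<xi> \<in> carrier H" and unit: "cinner H \<xi> \<xi> = 1"
  shows "minimal_idempotent BH (line_projection \<xi>)"
proof -
  let ?P = "line_projection \<xi>"
  have P: "?P \<in> bounded_operators H"
    unfolding line_projection_def
  proof (rule bounded_operatorI)
    fix x assume x: "x \<in> carrier H"
    have "hnorm H \<xi> = 1" using unit by (simp add: hnorm_def)
    then show "hnorm H (cinner H x \<xi> \<odot> \<xi>) \<le> 1 * hnorm H x"
      using Cauchy_Schwarz[OF x, of \<xi>] by (simp add: norm_smult)
  qed (simp_all add: cinner_add_left cinner_smult_left scale_add_left scale_scale)
  have val: "?P x = cinner H x \<xi> \<odot> \<xi>" if "x \<in> carrier H" for x
    using that by (simp add: line_projection_def)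
  have "?P \<noteq> \<zero>\<^bsub>BH\<^esub>"
  proof
    assume "?P = \<zero>\<^bsub>BH\<^esub>"
    then have "?P \<xi> = \<zero>" by simp
    then have "\<xi> = \<zero>" using unit by (simp add: val)
    then show False using unit cinner_zero_left[of \<xi>] by simp
  qed
  moreover have "?P \<otimes>\<^bsub>BH\<^esub> ?P = ?P"
    using P by (intro operator_eqI BH_closed) (simp_all add: val cinner_smult_left unit)
  moreover have "?P \<otimes>\<^bsub>BH\<^esub> (T \<otimes>\<^bsub>BH\<^esub> ?P) = cinner H (T \<xi>) \<xi> \<odot>\<^bsub>BH\<^esub> ?P" if "T \<in> carrier BH" for T
    using P that by (intro operator_eqI BH_closed)
      (simp_all add: val cinner_smult_left operator_scale scale_scale mult.commute)
  ultimately show ?thesis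
    using P unfolding minimal_idempotent_def by auto
qed

text \<open>Evaluating the quadratic form at x + y and x + iy gives <Tx, y> + <Ty, x> = 0 and <Tx,
  y> = <Ty, x>, so <Tx, y> = 0. The choice y = Tx makes this the squared norm of Tx.\<close>

lemma polarization_zero:
  assumes T: "T \<in> bounded_operators H" and 0: "\<And>\<xi>. \<xi> \<in> carrier H \<Longrightarrow> cinner H (T \<xi>) \<xi> = 0"
  shows "T = \<zero>\<^bsub>BH\<^esub>"
proof (rule operator_eqI)
  fix x assume x [simp]: "x \<in> carrier H"
  define y where "y = T x"
  have y [simp]: "y \<in> carrier H" using T by (simp add: y_def)
  have "cinner H (T x) y + cinner H (T y) x = 0"
    using 0[of "x \<oplus> y"] 0[of x] 0[of y] T
    by (simp add: operator_add cinner_add_left cinner_add_right add.commute)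
  moreover have "- \<i> * cinner H (T x) y + \<i> * cinner H (T y) x = 0"
    using 0[of "x \<oplus> \<i> \<odot> y"] 0[of x] 0[of y] T
    by (simp add: operator_add operator_scale cinner_add_left cinner_add_right cinner_smult_left cinner_smult_right)
  then have "\<i> * (cinner H (T y) x - cinner H (T x) y) = 0"
    by (simp add: algebra_simps)
  ultimately have "cinner H (T x) y = 0" by (simp add: add.commute)
  then show "T x = \<zero>\<^bsub>BH\<^esub> x"
    using cinner_eq_zero[OF y] by (simp add: y_def)
qed (use T in auto)

text \<open>Compression by the projection onto a unit vector reads off the quadratic form of T
  there. Rescaling extends its vanishing to all vectors, and polarization concludes.\<close>

lemma operators_separated: "separated_by_minimal_idempotents BH"
  unfolding separated_by_minimal_idempotents_def
proof (intro ballI impI)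
  fix T assume T: "T \<in> carrier BH"
    and sep: "\<forall>p. minimal_idempotent BH p \<longrightarrow> p \<otimes>\<^bsub>BH\<^esub> (T \<otimes>\<^bsub>BH\<^esub> p) = \<zero>\<^bsub>BH\<^esub>"
  have unit: "cinner H (T \<xi>) \<xi> = 0" if [simp]: "\<xi> \<in> carrier H" and "cinner H \<xi> \<xi> = 1" for \<xi>
  proof -
    have "(line_projection \<xi> \<otimes>\<^bsub>BH\<^esub> (T \<otimes>\<^bsub>BH\<^esub> line_projection \<xi>)) \<xi> = \<zero>\<^bsub>BH\<^esub> \<xi>"
      using sep line_projection_minimal[OF that] by simp
    then have "cinner H (T \<xi>) \<xi> \<odot> \<xi> = \<zero>"
      using T that by (simp add: line_projection_def)
    then have "cinner H (cinner H (T \<xi>) \<xi> \<odot> \<xi>) \<xi> = 0"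
      using cinner_zero_left[of \<xi>] by simp
    then show ?thesis using T that by (simp add: cinner_smult_left)
  qed
  show "T = \<zero>\<^bsub>BH\<^esub>"
  proof (rule polarization_zero)
    fix x assume x [simp]: "x \<in> carrier H"
    show "cinner H (T x) x = 0"
    proof (cases "x = \<zero>")
      case True
      then show ?thesis using T cinner_zero_left[of \<zero>] by simp
    next
      case False
      define r where "r = hnorm H x"
      have r: "r > 0"
        using False norm_eq_zero[OF x] norm_nonneg[OF x] by (simp add: r_def order_less_le)
      have "cinner H x x = complex_of_real (r\<^sup>2)"
        using cinner_self_real[OF x] hnorm_power2[OF x] by (simp add: r_def)
      then have "cinner H (T (complex_of_real (1 / r) \<odot> x)) (complex_of_real (1 / r) \<odot> x) = 0"
        using r by (intro unit) (simp_all add: cinner_smult_left cinner_smult_right power2_eq_square)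
      then show ?thesis
        using r T by (simp add: operator_scale cinner_smult_left cinner_smult_right)
    qed
  qed (use T in simp)
qed

lemma atomic_algebra_operators: "atomic_algebra BH"
  by (intro atomic_algebra.intro atomic_algebra_axioms.intro
      unital_normed_algebra_operators operators_separated)

end

section \<open>Sums of operator algebras\<close>

lemma linf_sum_simps [simp]:
  "a \<otimes>\<^bsub>linf_sum I B\<^esub> b = (\<lambda>i\<in>I. a i \<otimes>\<^bsub>B i\<^esub> b i)"
  "\<one>\<^bsub>linf_sum I B\<^esub> = (\<lambda>i\<in>I. \<one>\<^bsub>B i\<^esub>)"
  "\<zero>\<^bsub>linf_sum I B\<^esub> = (\<lambda>i\<in>I. \<zero>\<^bsub>B i\<^esub>)"
  "a \<oplus>\<^bsub>linf_sum I B\<^esub> b = (\<lambda>i\<in>I. a i \<oplus>\<^bsub>B i\<^esub> b i)"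
  "c \<odot>\<^bsub>linf_sum I B\<^esub> a = (\<lambda>i\<in>I. c \<odot>\<^bsub>B i\<^esub> a i)"
  by (simp_all add: linf_sum_def)

lemma linf_sum_carrier:
  "a \<in> carrier (linf_sum I B) \<longleftrightarrow>
    a \<in> extensional I \<and> (\<forall>i\<in>I. a i \<in> carrier (B i)) \<and> bdd_above ((\<lambda>i. anorm (B i) (a i)) ` I)"
  by (auto simp: linf_sum_def PiE_def)

text \<open>The canonical embedding of the \<open>i\<close>-th summand.\<close>

definition linf_single :: "'i set \<Rightarrow> ('i \<Rightarrow> 'a star_algebra) \<Rightarrow> 'i \<Rightarrow> 'a \<Rightarrow> 'i \<Rightarrow> 'a" where
  "linf_single I B i x = (\<lambda>j\<in>I. if j = i then x else \<zero>\<^bsub>B j\<^esub>)"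

lemma linf_single_closed:
  assumes B: "\<And>i. i \<in> I \<Longrightarrow> unital_normed_algebra (B i)" and i: "i \<in> I" and x: "x \<in> carrier (B i)"
  shows "linf_single I B i x \<in> carrier (linf_sum I B)"
  unfolding linf_sum_carrier
proof (intro conjI ballI)
  show "linf_single I B i x \<in> extensional I" by (simp add: linf_single_def)
  show "linf_single I B i x j \<in> carrier (B j)" if j: "j \<in> I" for j
  proof -
    interpret unital_normed_algebra "B j" by (rule B[OF j])
    show ?thesis using x j by (simp add: linf_single_def)
  qed
  show "bdd_above ((\<lambda>j. anorm (B j) (linf_single I B i x j)) ` I)"
  proof (rule bdd_aboveI2)
    fix j assume j: "j \<in> I"
    interpret unital_normed_algebra "B j" by (rule B[OF j])
    interpret i: unital_normed_algebra "B i" by (rule B[OF i])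
    show "anorm (B j) (linf_single I B i x j) \<le> anorm (B i) x"
      using j i.norm_nonneg[OF x] by (simp add: linf_single_def)
  qed
qed

text \<open>All coordinates of the embedded element except the \<open>i\<close>-th vanish, so the
  compression sees only \<open>y i\<close>. Minimality and separation in the sum thereby reduce to
  the summands.\<close>

lemma linf_single_corner:
  assumes B: "\<And>i. i \<in> I \<Longrightarrow> unital_normed_algebra (B i)" and i: "i \<in> I" and p: "p \<in> carrier (B i)"
    and y: "y \<in> carrier (linf_sum I B)"
  shows "linf_single I B i p \<otimes>\<^bsub>linf_sum I B\<^esub> (y \<otimes>\<^bsub>linf_sum I B\<^esub> linf_single I B i p)
    = linf_single I B i (p \<otimes>\<^bsub>B i\<^esub> (y i \<otimes>\<^bsub>B i\<^esub> p))"
proof -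
  have "linf_single I B i p j \<otimes>\<^bsub>B j\<^esub> (y j \<otimes>\<^bsub>B j\<^esub> linf_single I B i p j)
      = linf_single I B i (p \<otimes>\<^bsub>B i\<^esub> (y i \<otimes>\<^bsub>B i\<^esub> p)) j" if j: "j \<in> I" for j
  proof -
    interpret unital_normed_algebra "B j" by (rule B[OF j])
    show ?thesis using y j by (simp add: linf_single_def linf_sum_carrier)
  qed
  then show ?thesis by (auto simp: linf_single_def)
qed

lemma linf_single_minimal:
  assumes B: "\<And>i. i \<in> I \<Longrightarrow> unital_normed_algebra (B i)" and i: "i \<in> I"
    and p: "minimal_idempotent (B i) p"
  shows "minimal_idempotent (linf_sum I B) (linf_single I B i p)"
proof -
  let ?L = "linf_sum I B" and ?q = "linf_single I B i p"
  have p': "p \<in> carrier (B i)" "p \<noteq> \<zero>\<^bsub>B i\<^esub>" "p \<otimes>\<^bsub>B i\<^esub> p = p"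
    using p by (auto simp: minimal_idempotent_def)
  have scale: "linf_single I B i (c \<odot>\<^bsub>B i\<^esub> p) = c \<odot>\<^bsub>?L\<^esub> ?q" for c
  proof -
    have "c \<odot>\<^bsub>B j\<^esub> \<zero>\<^bsub>B j\<^esub> = \<zero>\<^bsub>B j\<^esub>" if "j \<in> I" for j
    proof -
      interpret unital_normed_algebra "B j" by (rule B[OF that])
      show ?thesis by simp
    qed
    then show ?thesis by (auto simp: linf_single_def)
  qed
  have "\<exists>c. ?q \<otimes>\<^bsub>?L\<^esub> (y \<otimes>\<^bsub>?L\<^esub> ?q) = c \<odot>\<^bsub>?L\<^esub> ?q" if y: "y \<in> carrier ?L" for y
  proof -
    have "y i \<in> carrier (B i)" using y i by (simp add: linf_sum_carrier)
    then obtain c where c: "p \<otimes>\<^bsub>B i\<^esub> (y i \<otimes>\<^bsub>B i\<^esub> p) = c \<odot>\<^bsub>B i\<^esub> p"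
      using p by (auto simp: minimal_idempotent_def)
    have "?q \<otimes>\<^bsub>?L\<^esub> (y \<otimes>\<^bsub>?L\<^esub> ?q) = c \<odot>\<^bsub>?L\<^esub> ?q"
      by (rule trans[OF linf_single_corner[where B = B, OF B i p'(1) y]]) (simp_all only: c scale)
    then show ?thesis ..
  qed
  moreover have "?q \<otimes>\<^bsub>?L\<^esub> ?q = ?q"
  proof -
    have "?q j \<otimes>\<^bsub>B j\<^esub> ?q j = ?q j" if "j \<in> I" for j
    proof -
      interpret unital_normed_algebra "B j" by (rule B[OF that])
      show ?thesis using that p' by (simp add: linf_single_def)
    qed
    then show ?thesis by (auto simp: linf_single_def)
  qed
  moreover have "?q \<noteq> \<zero>\<^bsub>?L\<^esub>"
  proof
    assume "?q = \<zero>\<^bsub>?L\<^esub>"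
    then have "?q i = \<zero>\<^bsub>?L\<^esub> i" by simp
    then show False using i p'(2) by (simp add: linf_single_def)
  qed
  ultimately show ?thesis
    using linf_single_closed[where B = B, OF B i p'(1)] unfolding minimal_idempotent_def by blast
qed

text \<open>Minimal idempotents of the summands, embedded into the sum, already detect each
  coordinate of an element.\<close>

lemma linf_sum_separated:
  assumes B: "\<And>i. i \<in> I \<Longrightarrow> atomic_algebra (B i)"
  shows "separated_by_minimal_idempotents (linf_sum I B)"
  unfolding separated_by_minimal_idempotents_def
proof (intro ballI impI)
  let ?L = "linf_sum I B"
  fix y assume y: "y \<in> carrier ?L"
    and 0: "\<forall>q. minimal_idempotent ?L q \<longrightarrow> q \<otimes>\<^bsub>?L\<^esub> (y \<otimes>\<^bsub>?L\<^esub> q) = \<zero>\<^bsub>?L\<^esub>"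
  have U: "unital_normed_algebra (B i)" if "i \<in> I" for i
    by (rule atomic_algebra.axioms(1)[OF B[OF that]])
  have "y i = \<zero>\<^bsub>B i\<^esub>" if i: "i \<in> I" for i
  proof -
    interpret atomic_algebra "B i" by (rule B[OF i])
    have "p \<otimes>\<^bsub>B i\<^esub> (y i \<otimes>\<^bsub>B i\<^esub> p) = \<zero>\<^bsub>B i\<^esub>" if p: "minimal_idempotent (B i) p" for p
    proof -
      have "linf_single I B i (p \<otimes>\<^bsub>B i\<^esub> (y i \<otimes>\<^bsub>B i\<^esub> p)) = \<zero>\<^bsub>?L\<^esub>"
        using 0 linf_single_minimal[where B = B, OF U i p] linf_single_corner[where B = B, OF U i minimal_idempotent_closed[OF p] y]
        by metis
      then have "linf_single I B i (p \<otimes>\<^bsub>B i\<^esub> (y i \<otimes>\<^bsub>B i\<^esub> p)) i = \<zero>\<^bsub>?L\<^esub> i" by (rule fun_cong)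
      then show ?thesis using i by (simp add: linf_single_def)
    qed
    moreover have "y i \<in> carrier (B i)" using y i by (simp add: linf_sum_carrier)
    ultimately show ?thesis
      using separated unfolding separated_by_minimal_idempotents_def by blast
  qed
  then show "y = \<zero>\<^bsub>?L\<^esub>"
    using y by (intro extensionalityI[of _ I]) (simp_all add: linf_sum_carrier)
qed

text \<open>A bound common to all indices is what places the family of units in the sum; for
  operator algebras it is 1.\<close>

lemma linf_sum_unit:
  assumes B: "\<And>i. i \<in> I \<Longrightarrow> unital_normed_algebra (B i)"
    and one: "\<And>i. i \<in> I \<Longrightarrow> anorm (B i) \<one>\<^bsub>B i\<^esub> \<le> K"
  shows "\<one>\<^bsub>linf_sum I B\<^esub> \<in> carrier (linf_sum I B)"
    and "y \<in> carrier (linf_sum I B) \<Longrightarrow> \<one>\<^bsub>linf_sum I B\<^esub> \<otimes>\<^bsub>linf_sum I B\<^esub> y = y"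
    and "y \<in> carrier (linf_sum I B) \<Longrightarrow> y \<otimes>\<^bsub>linf_sum I B\<^esub> \<one>\<^bsub>linf_sum I B\<^esub> = y"
proof -
  have *: "\<one>\<^bsub>B i\<^esub> \<in> carrier (B i)" "x \<in> carrier (B i) \<Longrightarrow> \<one>\<^bsub>B i\<^esub> \<otimes>\<^bsub>B i\<^esub> x = x"
    "x \<in> carrier (B i) \<Longrightarrow> x \<otimes>\<^bsub>B i\<^esub> \<one>\<^bsub>B i\<^esub> = x" if "i \<in> I" for i x
  proof -
    interpret unital_normed_algebra "B i" by (rule B[OF that])
    show "\<one>\<^bsub>B i\<^esub> \<in> carrier (B i)" "x \<in> carrier (B i) \<Longrightarrow> \<one>\<^bsub>B i\<^esub> \<otimes>\<^bsub>B i\<^esub> x = x"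
      "x \<in> carrier (B i) \<Longrightarrow> x \<otimes>\<^bsub>B i\<^esub> \<one>\<^bsub>B i\<^esub> = x"
      by simp_all
  qed
  show "\<one>\<^bsub>linf_sum I B\<^esub> \<in> carrier (linf_sum I B)"
    using * one by (auto simp: linf_sum_carrier intro!: bdd_aboveI2[where M = K])
  show "y \<in> carrier (linf_sum I B) \<Longrightarrow> \<one>\<^bsub>linf_sum I B\<^esub> \<otimes>\<^bsub>linf_sum I B\<^esub> y = y"
    "y \<in> carrier (linf_sum I B) \<Longrightarrow> y \<otimes>\<^bsub>linf_sum I B\<^esub> \<one>\<^bsub>linf_sum I B\<^esub> = y"
    using * by (auto intro!: extensionalityI[of _ I] simp: linf_sum_carrier)
qed

text \<open>
  The field \<^const>\<open>one\<close> of a C*-algebra is arbitrary, so the unit of an atomic von Neumann algebra has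
  to be installed by a record update; none of the notions in the theorem depends on that field.
\<close>

lemma one_update_module: "module complex_field (A\<lparr>one := u\<rparr>) \<longleftrightarrow> module complex_field A"
  by (simp add: module_def module_axioms_def abelian_group_def abelian_monoid_def
      abelian_group_axioms_def)

lemma one_update_norm:
  "complex_normed_space (A\<lparr>one := u\<rparr>) N \<longleftrightarrow> complex_normed_space A N"
  by (simp add: complex_normed_space_def one_update_module complex_normed_space_axioms_def)

lemma derivation_one_update: "derivation (A\<lparr>one := u\<rparr>) D \<longleftrightarrow> derivation A D"
  by (simp add: derivation_def linear_maps_def)

lemma w2ld_one_update: "weak_2_local_derivation (A\<lparr>one := u\<rparr>) \<Delta> \<longleftrightarrow> weak_2_local_derivation A \<Delta>"
  by (simp add: weak_2_local_derivation_def derivation_one_update dual_space_def linear_maps_def)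

lemma continuous_functions_one_update:
  "continuous_functions \<Omega> (A\<lparr>one := u\<rparr>) = (continuous_functions \<Omega> A)\<lparr>one := \<lambda>t\<in>topspace \<Omega>. u\<rparr>"
proof -
  have "norm_topology (A\<lparr>one := u\<rparr>) = norm_topology A"
    by (simp add: norm_topology_def norm_dist_def[abs_def] a_minus_def a_inv_def cong: if_cong)
  then show ?thesis by (simp add: continuous_functions_def)
qed

text \<open>\<open>u\<close> is the preimage of the unit of the sum. Only algebraic structure
  travels along \<pi>: minimal idempotents and separation are pulled back, while the norm estimates
  are those of \<open>A\<close> itself.\<close>

lemma (in cstar_algebra) star_isomorphic_linf_sum_unit:
  assumes H: "\<And>i. i \<in> I \<Longrightarrow> hilbert_space (H i)"
    and \<pi>: "\<pi> \<in> star_isomorphisms A (linf_sum I (\<lambda>i. operator_algebra (H i)))"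
  obtains u where "atomic_algebra (A\<lparr>one := u\<rparr>)"
proof -
  let ?B = "\<lambda>i. operator_algebra (H i)"
  let ?L = "linf_sum I ?B"
  have IP: "complex_inner_product_space (H i)" if "i \<in> I" for i
    using H[OF that] by (rule hilbert_space.axioms(1))
  have B: "atomic_algebra (?B i)" if "i \<in> I" for i
    by (rule complex_inner_product_space.atomic_algebra_operators[OF IP[OF that]])
  have U: "unital_normed_algebra (?B i)" if "i \<in> I" for i
    by (rule atomic_algebra.axioms(1)[OF B[OF that]])
  note unit = linf_sum_unit[where B = ?B, OF U complex_inner_product_space.anorm_one_le[OF IP]]
  have \<pi>_bij: "bij_betw \<pi> (carrier A) (carrier ?L)"
    and \<pi>_mult: "\<And>x y. \<lbrakk>x \<in> carrier A; y \<in> carrier A\<rbrakk> \<Longrightarrow> \<pi> (x \<otimes> y) = \<pi> x \<otimes>\<^bsub>?L\<^esub> \<pi> y"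
    and \<pi>_scale: "\<And>c x. x \<in> carrier A \<Longrightarrow> \<pi> (c \<odot> x) = c \<odot>\<^bsub>?L\<^esub> \<pi> x"
    using \<pi> unfolding star_isomorphisms_def linear_maps_def by blast+
  have \<pi>_closed: "\<pi> x \<in> carrier ?L" if "x \<in> carrier A" for x
    using \<pi>_bij that by (rule bij_betw_apply)
  have \<pi>_inj: "x = y" if "x \<in> carrier A" "y \<in> carrier A" "\<pi> x = \<pi> y" for x y
    using \<pi>_bij that unfolding bij_betw_def inj_on_def by blast
  have \<pi>_surj: "\<exists>x\<in>carrier A. \<pi> x = y" if "y \<in> carrier ?L" for y
    using that unfolding bij_betw_imp_surj_on[OF \<pi>_bij, symmetric] by blast
  \<comment> \<open>\<open>\<pi> \<zero>\<close> equals 0 times itself, and such a multiple is zero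
    in each summand.\<close>
  have \<pi>_zero: "\<pi> \<zero> = \<zero>\<^bsub>?L\<^esub>"
  proof -
    have "0 \<odot>\<^bsub>?B i\<^esub> \<pi> \<zero> i = \<zero>\<^bsub>?B i\<^esub>" if i: "i \<in> I" for i
    proof -
      interpret i: unital_normed_algebra "?B i" by (rule U[OF i])
      have "\<pi> \<zero> i \<in> carrier (?B i)"
        using \<pi>_closed[of \<zero>] i by (simp only: linf_sum_carrier M.zero_closed)
      then show ?thesis by (rule i.scale_zero_left)
    qed
    then have "0 \<odot>\<^bsub>?L\<^esub> \<pi> \<zero> = \<zero>\<^bsub>?L\<^esub>"
      unfolding linf_sum_simps by (rule restrict_ext)
    then show ?thesis
      using \<pi>_scale[of \<zero> 0] by (simp only: scale_zero_right M.zero_closed)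
  qed
  obtain u where u: "u \<in> carrier A" and \<pi>u: "\<pi> u = \<one>\<^bsub>?L\<^esub>"
    using \<pi>_surj[OF unit(1)] by blast
  let ?A = "A\<lparr>one := u\<rparr>"
  have one: "u \<otimes> x = x" "x \<otimes> u = x" if "x \<in> carrier A" for x
    by (rule \<pi>_inj[OF mult_closed[OF u that] that], simp only: \<pi>_mult u that \<pi>u unit(2) \<pi>_closed)
       (rule \<pi>_inj[OF mult_closed[OF that u] that], simp only: \<pi>_mult u that \<pi>u unit(3) \<pi>_closed)
  have mod: "module complex_field ?A"
    unfolding one_update_module by unfold_locales
  have "ring ?A"
  proof (rule ringI)
    show "abelian_group ?A" by (rule module.axioms(2)[OF mod])
    show "Group.monoid ?A"
      by (rule monoidI) (simp_all add: u one mult_closed mult_assoc)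
  qed (simp_all add: distrib_left distrib_right)
  then have uA: "unital_normed_algebra ?A"
    by (intro unital_normed_algebra.intro unital_normed_algebra_axioms.intro)
       (simp_all add: one_update_norm complex_normed_space_axioms smult_mult_left smult_mult_right anorm_mult)
  \<comment> \<open>The coefficient c belonging to \<open>q\<close> and \<open>\<pi> x\<close> also
    serves for the preimage \<open>p\<close> and \<open>x\<close>, by injectivity of \<pi>.\<close>
  have minimal: "\<exists>p. minimal_idempotent ?A p \<and> \<pi> p = q" if q: "minimal_idempotent ?L q" for q
  proof -
    have q': "q \<in> carrier ?L" "q \<noteq> \<zero>\<^bsub>?L\<^esub>" "q \<otimes>\<^bsub>?L\<^esub> q = q"
      using q unfolding minimal_idempotent_def by blast+
    obtain p where p: "p \<in> carrier A" "\<pi> p = q" using \<pi>_surj[OF q'(1)] by blast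
    have "p \<noteq> \<zero>" using \<pi>_zero p q'(2) by metis
    moreover have "p \<otimes> p = p"
      using p q'(3) by (intro \<pi>_inj mult_closed) (simp_all only: \<pi>_mult)
    moreover have "\<exists>c. p \<otimes> (x \<otimes> p) = c \<odot> p" if x: "x \<in> carrier A" for x
    proof -
      obtain c where "q \<otimes>\<^bsub>?L\<^esub> (\<pi> x \<otimes>\<^bsub>?L\<^esub> q) = c \<odot>\<^bsub>?L\<^esub> q"
        using q \<pi>_closed[OF x] unfolding minimal_idempotent_def by blast
      then have "p \<otimes> (x \<otimes> p) = c \<odot> p"
        using p x by (intro \<pi>_inj mult_closed scale_closed) (simp_all only: \<pi>_mult \<pi>_scale mult_closed)
      then show ?thesis ..
    qed
    ultimately show ?thesis
      using p by (auto simp: minimal_idempotent_def)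
  qed
  have "separated_by_minimal_idempotents ?A"
    unfolding separated_by_minimal_idempotents_def
  proof (intro ballI impI)
    fix x assume "x \<in> carrier ?A"
      and 0: "\<forall>p. minimal_idempotent ?A p \<longrightarrow> p \<otimes>\<^bsub>?A\<^esub> (x \<otimes>\<^bsub>?A\<^esub> p) = \<zero>\<^bsub>?A\<^esub>"
    then have x: "x \<in> carrier A" by simp
    have "q \<otimes>\<^bsub>?L\<^esub> (\<pi> x \<otimes>\<^bsub>?L\<^esub> q) = \<zero>\<^bsub>?L\<^esub>" if q: "minimal_idempotent ?L q" for q
    proof -
      obtain p where p: "minimal_idempotent ?A p" "\<pi> p = q" using minimal[OF q] by blast
      have pA: "p \<in> carrier A" using p(1) by (simp add: minimal_idempotent_def)
      have "p \<otimes> (x \<otimes> p) = \<zero>" using 0 p(1) by simp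
      then have "\<pi> (p \<otimes> (x \<otimes> p)) = \<zero>\<^bsub>?L\<^esub>" by (simp only: \<pi>_zero)
      then show ?thesis
        using x pA by (simp only: \<pi>_mult mult_closed p(2))
    qed
    then have "\<pi> x = \<zero>\<^bsub>?L\<^esub>"
      using linf_sum_separated[where B = ?B, OF B] \<pi>_closed[OF x]
      unfolding separated_by_minimal_idempotents_def by blast
    then show "x = \<zero>\<^bsub>?A\<^esub>"
      using x \<pi>_zero by (intro \<pi>_inj) simp_all
  qed
  then have "atomic_algebra ?A"
    using uA by (intro atomic_algebra.intro atomic_algebra_axioms.intro)
  then show ?thesis by (rule that)
qed

lemma atomic_von_neumann_algebra_unit:
  assumes "atomic_von_neumann_algebra TYPE('i) TYPE('h) A"
  obtains u where "atomic_algebra (A\<lparr>one := u\<rparr>)"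
proof -
  from assms obtain I :: "'i set" and H :: "'i \<Rightarrow> 'h inner_space" and \<pi>
    where "cstar_algebra A" "\<And>i. i \<in> I \<Longrightarrow> hilbert_space (H i)"
      "\<pi> \<in> star_isomorphisms A (linf_sum I (\<lambda>i. operator_algebra (H i)))"
    unfolding atomic_von_neumann_algebra_def by blast
  then show ?thesis
    by (rule cstar_algebra.star_isomorphic_linf_sum_unit) (assumption, rule that)
qed

lemma w2ld_continuous_functions:
  assumes "compact_space \<Omega>" "atomic_algebra A"
    and "weak_2_local_derivation (continuous_functions \<Omega> A) \<Delta>"
  shows "derivation (continuous_functions \<Omega> A) \<Delta>"
proof -
  interpret atomic_algebra A by (rule assms(2))
  interpret continuous_functions_atomic A \<Omega> by unfold_locales (rule assms(1))
  show ?thesis by (rule w2ld_imp_derivation[OF assms(3)])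
qed

theorem corollary2p5:
  fixes \<Omega> :: "'w topology"
  assumes "compact_space \<Omega>" and "Hausdorff_space \<Omega>"
  shows "(\<forall>H :: 'k inner_space. hilbert_space H \<longrightarrow>
            (\<forall>\<Delta>. weak_2_local_derivation (continuous_functions \<Omega> (operator_algebra H)) \<Delta> \<longrightarrow>
                 derivation (continuous_functions \<Omega> (operator_algebra H)) \<Delta>)) \<and>
         (\<forall>A :: 'a star_algebra. atomic_von_neumann_algebra TYPE('i) TYPE('h) A \<longrightarrow>
            (\<forall>\<Delta>. weak_2_local_derivation (continuous_functions \<Omega> A) \<Delta> \<longrightarrow>
                 derivation (continuous_functions \<Omega> A) \<Delta>))"
proof (intro conjI allI impI)
  fix H :: "'k inner_space" and \<Delta>
  assume "hilbert_space H"
  then have "atomic_algebra (operator_algebra H)"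
    by (intro complex_inner_product_space.atomic_algebra_operators hilbert_space.axioms(1))
  then show "weak_2_local_derivation (continuous_functions \<Omega> (operator_algebra H)) \<Delta> \<Longrightarrow>
      derivation (continuous_functions \<Omega> (operator_algebra H)) \<Delta>"
    by (rule w2ld_continuous_functions[OF assms(1)])
next
  fix A :: "'a star_algebra" and \<Delta>
  assume "atomic_von_neumann_algebra TYPE('i) TYPE('h) A"
  then obtain u where "atomic_algebra (A\<lparr>one := u\<rparr>)"
    by (rule atomic_von_neumann_algebra_unit)
  \<comment> \<open>The result is obtained with the unit \<open>u\<close> in place and then carried
    back by the \<open>one\<close>-update lemmas.\<close>
  then have "weak_2_local_derivation (continuous_functions \<Omega> (A\<lparr>one := u\<rparr>)) \<Delta> \<Longrightarrow>
      derivation (continuous_functions \<Omega> (A\<lparr>one := u\<rparr>)) \<Delta>"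
    by (rule w2ld_continuous_functions[OF assms(1)])
  then show "weak_2_local_derivation (continuous_functions \<Omega> A) \<Delta> \<Longrightarrow>
      derivation (continuous_functions \<Omega> A) \<Delta>"
    by (simp only: continuous_functions_one_update derivation_one_update w2ld_one_update)
qed

end
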